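(* For integers $n\ge r\ge 0$, \[ \sum_{R\in\mathrm{RAT}(n,r)}\alpha^{\mathrm{frow}(R)}\beta^{\mathrm{fcol}(R)}z_1^{a_1(R)}\cdots z_r^{a_r(R)}=\binom{n}{r}(\alpha+\beta+z_1+\cdots+z_r)_{n-r}, \] where $(x)_m=x(x+1)\cdots(x+m-1)$ (and $(x)_0=1$).
   Context: Rhombic diagrams. For a word $w=w_1\cdots w_n\in\{0,1,2\}^n$, the rhombic diagram $\Gamma_w$ is the region bounded by two lattice paths from a common starting point: the southeast border, obtained by reading $w$ left to right and taking a unit step south for each $2$, southwest (vector $(-1,-1)$) for each $1$, west for each $0$; and the northwest border, consisting of (number of $0$'s) steps west, then (number of $1$'s) steps southwest, then (number of $2$'s) steps south. It is tiled by unit squares, tall rhombi (two vertical, two diagonal sides) and short rhombi (two horizontal, two diagonal sides) via the maximal tiling: if no $i$ has $w_i>w_{i+1}$ there is nothing to tile; otherwise take the smallest such $i$, tile the region of the word obtained by swapping $w_i,w_{i+1}$, and fill the remaining tile by a tall rhombus, square or short rhombus according as $(w_i,w_{i+1})=(2,1),(2,0),(1,0)$. Label the southeast border edges $1,\dots,n$ from northeast to southwest. A strip is a maximal sequence of tiles connected through parallel edges; each border edge starts a strip (possibly empty) ending at the northwest border. Strips starting at vertical edges are rows, at horizontal edges columns, at diagonal edges diagonal strips. A rhombic alternative tableau (RAT) of shape $w$ is a filling of some tiles with up-arrows (only in tiles belonging to a column) and left-arrows (only in tiles belonging to a row) such that no arrow lies in a cell pointed to by another arrow, where a left-arrow points to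 all other cells of its row to its west (toward the northwest border) and an up-arrow to all other cells of its column to its north. $\mathrm{RAT}(n,r)$ is the set of RAT whose shape has length $n$ with exactly $r$ letters equal to $1$. $\mathrm{frow}(R)$ is the number of rows with no left-arrow, $\mathrm{fcol}(R)$ the number of columns with no up-arrow, and $a_i(R)$ is the number of arrows in the cells of the $i$-th topmost diagonal strip (the diagonal strip with the $i$-th smallest label), $1\le i\le r$. *)

theory Defs
  imports "HOL-Library.Product_Plus"
begin

section \<open>Rhombic diagrams and their maximal tilings\<close>

type_synonym point = "int \<times> int"

text \<open>Letters are 0, 1, 2; all other naturals are excluded by \<open>is_word\<close>.\<close>

definition is_word :: "nat list \<Rightarrow> bool" where
  "is_word w \<longleftrightarrow> set w \<subseteq> {0, 1, 2}"

definition step :: "nat \<Rightarrow> point" where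
  "step a = (if a = 2 then (0, -1) else if a = 1 then (-1, -1) else (-1, 0))"

text \<open>The \<open>i\<close>-th vertex of the southeast border, with the starting point (vertex 0) at the origin.\<close>

definition border_vertex :: "nat list \<Rightarrow> nat \<Rightarrow> point" where
  "border_vertex w i = sum_list (map step (take i w))"

text \<open>The edge \<open>(p, a)\<close> is the unit segment from \<open>p\<close> to \<open>p + step a\<close>.
  Border edges are indexed from 0, so \<open>border_edge w i\<close> carries the label \<open>i + 1\<close>.\<close>

type_synonym edge = "point \<times> nat"

definition border_edge :: "nat list \<Rightarrow> nat \<Rightarrow> edge" where
  "border_edge w i = (border_vertex w i, w ! i)"

text \<open>\<open>Tile p a b\<close> with \<open>a > b\<close> is the parallelogram with northeast corner \<open>p\<close> spanned by
  \<open>step a\<close> and \<open>step b\<close>: a tall rhombus, square or short rhombus according as \<open>(a, b)\<close> is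
  \<open>(2, 1)\<close>, \<open>(2, 0)\<close> or \<open>(1, 0)\<close>. Its southeast side runs along \<open>step a\<close> and then \<open>step b\<close>,
  its northwest side along \<open>step b\<close> and then \<open>step a\<close>.\<close>

datatype tile = Tile point nat nat

text \<open>\<open>crosses t e e'\<close>: the edges \<open>e\<close> and \<open>e'\<close> are parallel sides of the tile \<open>t\<close>, where \<open>e\<close> is
  on its southeast side and \<open>e'\<close> on its northwest side.\<close>

fun crosses :: "tile \<Rightarrow> edge \<Rightarrow> edge \<Rightarrow> bool" where
  "crosses (Tile p a b) e e' \<longleftrightarrow>
     (e = (p, a) \<and> e' = (p + step b, a)) \<or> (e = (p + step a, b) \<and> e' = (p, b))"

definition descent :: "nat list \<Rightarrow> nat \<Rightarrow> bool" where
  "descent w i \<longleftrightarrow> Suc i < length w \<and> w ! i > w ! Suc i"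

definition swap_at :: "nat list \<Rightarrow> nat \<Rightarrow> nat list" where
  "swap_at w i = w[i := w ! Suc i, Suc i := w ! i]"

lemma weight_swap_at_less:
  assumes "descent w i"
  shows "(\<Sum>j<length w. swap_at w i ! j * (length w - j)) < (\<Sum>j<length w. w ! j * (length w - j))"
proof -
  define n where "n = length w"
  have i: "Suc i < n" and gt: "w ! i > w ! Suc i"
    using assms by (auto simp: descent_def n_def)
  have split: "(\<Sum>j<n. f j) = f i + f (Suc i) + (\<Sum>j\<in>{..<n} - {i, Suc i}. f j)" for f :: "nat \<Rightarrow> nat"
    using i sum.subset_diff[of "{i, Suc i}" "{..<n}" f] by auto
  have rest: "(\<Sum>j\<in>{..<n} - {i, Suc i}. swap_at w i ! j * (n - j)) =
        (\<Sum>j\<in>{..<n} - {i, Suc i}. w ! j * (n - j))"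
    by (rule sum.cong) (auto simp: swap_at_def)
  obtain k where k: "n - i = Suc k" "n - Suc i = k"
    using i by (metis Suc_diff_Suc Suc_lessD)
  have "swap_at w i ! i = w ! Suc i" "swap_at w i ! Suc i = w ! i"
    using i by (auto simp: swap_at_def n_def)
  then show ?thesis
    using gt unfolding n_def[symmetric] split rest by (simp add: k)
qed

lemma length_swap_at [simp]: "length (swap_at w i) = length w"
  by (simp add: swap_at_def)

function tiling :: "nat list \<Rightarrow> tile set" where
  "tiling w =
     (if \<exists>i. descent w i
      then let i = (LEAST i. descent w i)
           in insert (Tile (border_vertex w i) (w ! i) (w ! Suc i)) (tiling (swap_at w i))
      else {})"
  by auto
termination
proof (relation "measure (\<lambda>w. \<Sum>j<length w. w ! j * (length w - j))", goal_cases)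
  case 1
  show ?case by simp
next
  case (2 w i)
  then have "descent w i"
    by (metis LeastI)
  then show ?case
    using weight_swap_at_less[of w i] by (simp only: in_measure length_swap_at)
qed

declare tiling.simps [simp del]

section \<open>Strips\<close>

text \<open>Pairs \<open>(t, u)\<close> of tiles such that \<open>u\<close> comes right after \<open>t\<close>, on the way from the southeast
  to the northwest border, in a strip whose connecting edges are those of the letter \<open>k\<close>.\<close>

definition next_tile :: "nat list \<Rightarrow> nat \<Rightarrow> (tile \<times> tile) set" where
  "next_tile w k =
     {(t, u). t \<in> tiling w \<and> u \<in> tiling w \<and>
        (\<exists>p e e'. crosses t e (p, k) \<and> crosses u (p, k) e')}"

text \<open>The set of tiles of the strip starting at the border edge \<open>i\<close>.\<close>

definition strip :: "nat list \<Rightarrow> nat \<Rightarrow> tile set" where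
  "strip w i =
     {u. \<exists>t\<in>tiling w. (\<exists>e'. crosses t (border_edge w i) e') \<and> (t, u) \<in> (next_tile w (w ! i))\<^sup>*}"

text \<open>Strips are referred to by the indices of their border edges, since distinct strips may be
  equal (empty) as sets of tiles.\<close>

definition positions :: "nat list \<Rightarrow> nat \<Rightarrow> nat set" where
  "positions w a = {i. i < length w \<and> w ! i = a}"

abbreviation rows :: "nat list \<Rightarrow> nat set" where "rows w \<equiv> positions w 2"
abbreviation columns :: "nat list \<Rightarrow> nat set" where "columns w \<equiv> positions w 0"
abbreviation diagonals :: "nat list \<Rightarrow> nat set" where "diagonals w \<equiv> positions w 1"

section \<open>Rhombic alternative tableaux\<close>

datatype arrow = UpArrow | LeftArrow

type_synonym filling = "tile \<Rightarrow> arrow option"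

fun points_to :: "nat list \<Rightarrow> arrow \<Rightarrow> tile \<Rightarrow> tile \<Rightarrow> bool" where
  "points_to w LeftArrow t u \<longleftrightarrow> (t, u) \<in> (next_tile w 2)\<^sup>+"
| "points_to w UpArrow t u \<longleftrightarrow> (t, u) \<in> (next_tile w 0)\<^sup>+"

definition is_RAT :: "nat list \<Rightarrow> filling \<Rightarrow> bool" where
  "is_RAT w R \<longleftrightarrow>
     dom R \<subseteq> tiling w \<and>
     (\<forall>t. R t = Some UpArrow \<longrightarrow> (\<exists>i\<in>columns w. t \<in> strip w i)) \<and>
     (\<forall>t. R t = Some LeftArrow \<longrightarrow> (\<exists>i\<in>rows w. t \<in> strip w i)) \<and>
     (\<forall>t u d. R t = Some d \<and> points_to w d t u \<longrightarrow> R u = None)"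

text \<open>A tableau is paired with its shape, which the filling alone does not determine.\<close>

definition RAT :: "nat \<Rightarrow> nat \<Rightarrow> (nat list \<times> filling) set" where
  "RAT n r = {(w, R). is_word w \<and> length w = n \<and> count_list w 1 = r \<and> is_RAT w R}"

fun frow :: "nat list \<times> filling \<Rightarrow> nat" where
  "frow (w, R) = card {i \<in> rows w. \<forall>t\<in>strip w i. R t \<noteq> Some LeftArrow}"

fun fcol :: "nat list \<times> filling \<Rightarrow> nat" where
  "fcol (w, R) = card {i \<in> columns w. \<forall>t\<in>strip w i. R t \<noteq> Some UpArrow}"

text \<open>The number of arrows in the \<open>i\<close>-th topmost diagonal strip, for \<open>i\<close> from 1 to the number of
  diagonal strips.\<close>

fun diag_arrows :: "nat \<Rightarrow> nat list \<times> filling \<Rightarrow> nat" where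
  "diag_arrows i (w, R) =
     card {t \<in> strip w (sorted_list_of_set (diagonals w) ! (i - 1)). R t \<noteq> None}"

end

theory Submission
  imports Defs "HOL-Library.Multiset"
begin

text \<open>Two strips cross exactly when their letters form an inversion, and the maximal tiling bubble-sorts the
  letters of the word into the sorted prefix one after the other. Hence a row meets the other strips from
  left to right in the word, while the strip of a letter \<open>0\<close> first meets the rows and then the diagonal
  strips, each from the last to the first. A tableau of \<open>w @ [x]\<close> thus is a tableau of \<open>w\<close> with a filling
  of the strip of \<open>x\<close>, whose cells in rows that already have a left-arrow stay empty.

  Let \<open>G(\<alpha>)\<close> be the weight of all tableaux of \<open>w\<close>, and let \<open>w\<close> have \<open>k\<close> letters \<open>1\<close>. Appending \<open>2\<close> gives
  \<open>\<alpha> G(\<alpha>)\<close>. Appending \<open>1\<close> lets each free row take a left-arrow of weight \<open>z (k + 1)\<close>, which gives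
  \<open>G(\<alpha> + z (k + 1))\<close>. Appending \<open>0\<close> gives \<open>(\<alpha> + \<beta> + z 1 + \<dots> + z k) G(\<alpha> + 1) - \<alpha> G(\<alpha>)\<close>: the factor \<open>\<beta>\<close> is for no
  up-arrow, \<open>z i\<close> for one in the \<open>i\<close>-th diagonal strip, and the up-arrows in free rows contribute a
  telescoping sum. The terms \<open>\<alpha> G(\<alpha>)\<close> cancel in the sum over all words, and the remaining recurrence
  is Pascal's rule combined with the recurrence of the rising factorial.\<close>

section \<open>The tiles of the maximal tiling\<close>

lemma no_descent_iff_sorted: "(\<nexists>i. descent w i) \<longleftrightarrow> sorted w"
  unfolding descent_def sorted_iff_nth_Suc by (meson not_less)

lemma tiling_sorted: "sorted w \<Longrightarrow> tiling w = {}"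
  using no_descent_iff_sorted[of w] by (subst tiling.simps) metis

lemma tiling_least_descent:
  assumes "descent w d" "\<And>i. descent w i \<Longrightarrow> d \<le> i"
  shows "tiling w = insert (Tile (border_vertex w d) (w ! d) (w ! Suc d)) (tiling (swap_at w d))"
proof -
  have "(LEAST i. descent w i) = d"
    using assms by (intro Least_equality)
  then show ?thesis
    using assms(1) by (subst tiling.simps) (auto simp: Let_def)
qed

lemma descent_snoc:
  "descent (w @ [x]) i \<longleftrightarrow> descent w i \<or> (Suc i = length w \<and> w ! i > x)"
  by (auto simp: descent_def nth_append less_Suc_eq)

lemma mset_swap_at: "descent w i \<Longrightarrow> mset (swap_at w i) = mset w"
  unfolding swap_at_def descent_def by (rule mset_swap) auto

text \<open>As long as \<open>w\<close> has a descent, the least descent of \<open>w @ [x]\<close>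
  is that of \<open>w\<close>, so the recursion first sorts \<open>w\<close> exactly as for
  \<open>w\<close> alone; what remains is the tiling of \<open>sort w @ [x]\<close>. Swaps keep the
  multiset and hence the sorted word.\<close>

lemma tiling_snoc: "tiling (w @ [x]) = tiling w \<union> tiling (sort w @ [x])"
proof (induction w rule: tiling.induct)
  case (1 w)
  show ?case
  proof (cases "\<exists>i. descent w i")
    case True
    define d where "d = (LEAST i. descent w i)"
    have d: "descent w d"
      unfolding d_def using True by (metis LeastI)
    have le: "d \<le> i" if "descent w i" for i
      unfolding d_def using that by (rule Least_le)
    have len: "Suc d < length w"
      using d by (simp add: descent_def)
    have IH: "tiling (swap_at w d @ [x]) = tiling (swap_at w d) \<union> tiling (sort (swap_at w d) @ [x])"
      using "1.IH"[OF True d_def] .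
    have srt: "sort (swap_at w d) = sort w"
      by (metis mset_swap_at[OF d] mset_sort properties_for_sort sorted_sort)
    have "tiling (w @ [x]) = insert (Tile (border_vertex (w @ [x]) d) ((w @ [x]) ! d) ((w @ [x]) ! Suc d))
        (tiling (swap_at (w @ [x]) d))"
      using d le len by (intro tiling_least_descent) (auto simp: descent_snoc)
    also have "swap_at (w @ [x]) d = swap_at w d @ [x]"
      using len by (simp add: swap_at_def list_update_append nth_append)
    also have "Tile (border_vertex (w @ [x]) d) ((w @ [x]) ! d) ((w @ [x]) ! Suc d) =
        Tile (border_vertex w d) (w ! d) (w ! Suc d)"
      using len by (simp add: border_vertex_def nth_append)
    finally show ?thesis
      using IH srt tiling_least_descent[OF d le] by auto
  next
    case False
    then have "sorted w"
      using no_descent_iff_sorted by blast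
    then show ?thesis
      by (simp add: tiling_sorted sorted_sort_id)
  qed
qed

text \<open>A descent can only be at the end, and the swaps carry \<open>x\<close> leftwards past
  the larger letters, one tile per letter. Removing the last letter \<open>y\<close> of the sorted
  word accounts for one swap.\<close>

lemma tiling_sorted_snoc:
  "sorted v \<Longrightarrow> tiling (v @ [x]) = {Tile (border_vertex v i) (v ! i) x |i. i < length v \<and> x < v ! i}"
proof (induction v rule: rev_induct)
  case Nil
  show ?case by (simp add: tiling_sorted)
next
  case (snoc y v)
  then have sv: "sorted v" and vy: "\<forall>a\<in>set v. a \<le> y"
    by (auto simp: sorted_append)
  show ?case
  proof (cases "x < y")
    case True
    let ?d = "length v"
    have des: "descent (v @ [y] @ [x]) i \<longleftrightarrow> i = ?d" for i
      using no_descent_iff_sorted[of "v @ [y]"] snoc.prems True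
      using descent_snoc[of "v @ [y]" x i] by (auto simp: nth_append)
    have "tiling (v @ [y] @ [x]) =
        insert (Tile (border_vertex v ?d) y x) (tiling (v @ [x] @ [y]))"
      using tiling_least_descent[of "v @ [y] @ [x]" ?d] des
      by (simp add: border_vertex_def swap_at_def nth_append list_update_append)
    \<comment> \<open>After the swap \<open>y\<close> is in its final place: no letter of
      \<open>v @ [x]\<close> exceeds it, so it splits off without a tile.\<close>
    also have "tiling (v @ [x] @ [y]) = tiling (v @ [x]) \<union> tiling (sort (v @ [x]) @ [y])"
      using tiling_snoc[of "v @ [x]" y] by simp
    also have "tiling (sort (v @ [x]) @ [y]) = {}"
      using vy True by (intro tiling_sorted) (auto simp: sorted_append simp del: sort_append)
    also have "tiling (v @ [x]) = {Tile (border_vertex v i) (v ! i) x |i. i < length v \<and> x < v ! i}"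
      by (rule snoc.IH[OF sv])
    finally show ?thesis
      using True by (auto simp: less_Suc_eq nth_append border_vertex_def)
  next
    case False
    then have "sorted ((v @ [y]) @ [x])"
      using snoc.prems vy by (auto simp: sorted_append)
    then have "tiling ((v @ [y]) @ [x]) = {}"
      by (rule tiling_sorted)
    moreover have "\<not> x < (v @ [y]) ! i" if "i < length (v @ [y])" for i
      using that False vy nth_mem[OF that] by auto
    ultimately show ?thesis
      by blast
  qed
qed

section \<open>Letter counts of prefixes and the cells of inversions\<close>

definition cnt :: "nat list \<Rightarrow> nat \<Rightarrow> nat \<Rightarrow> nat" where
  "cnt w a j = count_list (take j w) a"

lemma cnt_0 [simp]: "cnt w a 0 = 0"
  by (simp add: cnt_def)

lemma cnt_Suc: "j < length w \<Longrightarrow> cnt w a (Suc j) = cnt w a j + of_bool (w ! j = a)"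
  by (simp add: cnt_def take_Suc_conv_app_nth)

lemma cnt_snoc [simp]: "j \<le> length w \<Longrightarrow> cnt (w @ [x]) a j = cnt w a j"
  by (simp add: cnt_def)

lemma cnt_length: "cnt w a (length w) = count_list w a"
  by (simp add: cnt_def)

lemma cnt_mono: "i \<le> j \<Longrightarrow> cnt w a i \<le> cnt w a j"
  by (metis cnt_def count_list_append le_add1 le_add_diff_inverse take_add)

lemma cnt_less: "i < j \<Longrightarrow> j \<le> length w \<Longrightarrow> w ! i = a \<Longrightarrow> cnt w a i < cnt w a j"
  using cnt_Suc[of i w a] cnt_mono[of "Suc i" j w a] by simp

lemma cnt_inj: "i < length w \<Longrightarrow> j < length w \<Longrightarrow> w ! i = a \<Longrightarrow> w ! j = a \<Longrightarrow>
    cnt w a i = cnt w a j \<Longrightarrow> i = j"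
  by (metis cnt_less less_imp_le linorder_neqE_nat nat_neq_iff)

lemma cnt_surj: "j \<le> length w \<Longrightarrow> s < cnt w a j \<Longrightarrow> \<exists>i<j. w ! i = a \<and> cnt w a i = s"
proof (induction j)
  case (Suc j)
  then show ?case
    by (cases "s < cnt w a j") (auto simp: cnt_Suc less_Suc_eq of_bool_def split: if_splits)
qed simp

text \<open>The sum rises by one exactly after a letter 0 or 1. These letters move the border west
  and are the ones that a row can cross, so this finds the neighbours of a tile in its row.\<close>

lemma off_surj: "j \<le> length w \<Longrightarrow> s < cnt w 0 j + cnt w 1 j \<Longrightarrow>
    \<exists>i<j. w ! i < 2 \<and> cnt w 0 i + cnt w 1 i = s"
proof (induction j)
  case (Suc j)
  then show ?case
    by (cases "s < cnt w 0 j + cnt w 1 j") (auto simp: cnt_Suc less_Suc_eq of_bool_def split: if_splits)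
qed simp

lemma is_word_nth: "is_word w \<Longrightarrow> i < length w \<Longrightarrow> w ! i = 0 \<or> w ! i = 1 \<or> w ! i = 2"
  unfolding is_word_def using nth_mem by blast

lemma is_word_snoc [simp]: "is_word (w @ [x]) \<longleftrightarrow> is_word w \<and> x \<in> {0, 1, 2}"
  by (auto simp: is_word_def)

lemma border_vertex_eq:
  "is_word w \<Longrightarrow> i \<le> length w \<Longrightarrow>
    border_vertex w i = (- int (cnt w 0 i + cnt w 1 i), - int (cnt w 1 i + cnt w 2 i))"
proof (induction i)
  case 0
  show ?case by (simp add: border_vertex_def zero_prod_def)
next
  case (Suc i)
  then have "i < length w" by simp
  then have "border_vertex w (Suc i) = border_vertex w i + step (w ! i)"
    by (simp add: border_vertex_def take_Suc_conv_app_nth)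
  with Suc show ?case
    using is_word_nth[of w i] by (auto simp: cnt_Suc step_def)
qed

definition inversion :: "nat list \<Rightarrow> nat \<Rightarrow> nat \<Rightarrow> bool" where
  "inversion w i j \<longleftrightarrow> i < j \<and> j < length w \<and> w ! j < w ! i"

text \<open>The tile in which the strips of the border edges \<open>i < j\<close> cross. Least descents sort the word by
  insertion, so its northeast corner is the vertex reached by the stably sorted prefix of length
  \<open>j\<close> just before the edge \<open>i\<close>.\<close>

definition cell :: "nat list \<Rightarrow> nat \<Rightarrow> nat \<Rightarrow> tile" where
  "cell w i j = Tile (if w ! i = 2 then (- int (cnt w 0 j + cnt w 1 j), - int (cnt w 1 j + cnt w 2 i))
     else (- int (cnt w 0 j + cnt w 1 i), - int (cnt w 1 i))) (w ! i) (w ! j)"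

lemma inversion_snoc:
  "inversion (w @ [x]) i j \<longleftrightarrow> inversion w i j \<or> (j = length w \<and> i < length w \<and> x < w ! i)"
  by (auto simp: inversion_def nth_append)

lemma cell_snoc [simp]: "i < j \<Longrightarrow> j < length w \<Longrightarrow> cell (w @ [x]) i j = cell w i j"
  by (simp add: cell_def nth_append)

lemma sort_word:
  assumes "is_word w"
  shows "sort w = replicate (count_list w 0) 0 @ replicate (count_list w 1) 1 @ replicate (count_list w 2) 2"
proof (rule properties_for_sort)
  show "mset (replicate (count_list w 0) 0 @ replicate (count_list w 1) 1 @ replicate (count_list w 2) 2) = mset w"
    using assms by (induction w) (auto simp: is_word_def)
qed (auto simp: sorted_append)

lemma border_vertex_append:
  "border_vertex (u @ v) (length u + i) = border_vertex u (length u) + border_vertex v i"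
  by (simp add: border_vertex_def)

lemma border_vertex_replicate:
  "i \<le> n \<Longrightarrow> border_vertex (replicate n a) i = (int i * fst (step a), int i * snd (step a))"
proof (induction i)
  case (Suc i)
  then have "border_vertex (replicate n a) (Suc i) = border_vertex (replicate n a) i + step a"
    by (simp add: border_vertex_def take_Suc_conv_app_nth)
  with Suc show ?case
    by (simp add: prod_eq_iff algebra_simps)
qed (simp add: border_vertex_def zero_prod_def)

text \<open>\<open>sort w\<close> consists of a block of letters 0, then of 1, then of 2, and the
  letter of rank \<open>s\<close> in a block stands for the occurrence of rank \<open>s\<close> in
  \<open>w\<close>. Its border vertex in the sorted word is the corner used in
  \<open>cell\<close>.\<close>

lemma tiling_sort_snoc:
  assumes w: "is_word w"
  shows "tiling (sort w @ [x]) = {cell (w @ [x]) i (length w) |i. i < length w \<and> x < w ! i}"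
    (is "_ = ?N")
proof -
  define z q t where "z = count_list w 0" and "q = count_list w 1" and "t = count_list w 2"
  define v where "v = replicate z (0::nat) @ replicate q 1 @ replicate t 2"
  have v: "sort w = v"
    using sort_word[OF w] by (simp add: v_def z_def q_def t_def)
  have nv: "v ! i = (if i < z then 0 else if i < z + q then 1 else 2)" if "i < z + q + t" for i
    using that by (auto simp: v_def nth_append)
  have bv1: "border_vertex v (z + s) = (- int (z + s), - int s)" if "s \<le> q" for s
    using that border_vertex_append[of "replicate z 0" "replicate q 1 @ replicate t 2" s]
      border_vertex_replicate[of s q 1] border_vertex_replicate[of z z 0]
    by (simp add: v_def step_def) (simp add: border_vertex_def)
  have bv2: "border_vertex v (z + q + s) = (- int (z + q), - int (q + s))" if "s \<le> t" for s
    using that border_vertex_append[of "replicate z 0 @ replicate q 1" "replicate t 2" s]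
      border_vertex_append[of "replicate z 0" "replicate q 1" q]
      border_vertex_replicate[of s t 2] border_vertex_replicate[of q q 1] border_vertex_replicate[of z z 0]
    by (simp add: v_def step_def border_vertex_def)
  have len: "length v = z + q + t"
    by (simp add: v_def)
  have "tiling (sort w @ [x]) = {Tile (border_vertex v i) (v ! i) x |i. i < length v \<and> x < v ! i}"
    unfolding v[symmetric] by (rule tiling_sorted_snoc) simp
  also have "\<dots> = ?N"
  proof (intro equalityI subsetI; clarify)
    fix i assume i: "i < length v" "x < v ! i"
    \<comment> \<open>A letter above \<open>x\<close> is not 0, so \<open>i\<close> lies in one of
      the last two blocks, and \<open>s\<close> is its rank there.\<close>
    consider s where "s < q" "i = z + s" | s where "s < t" "i = z + q + s"
      using i len nv[of i] by (auto split: if_splits)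
        (metis le_Suc_ex nat_add_left_cancel_less not_less, metis add.assoc le_Suc_ex nat_add_left_cancel_less not_less)
    then show "\<exists>k. Tile (border_vertex v i) (v ! i) x = cell (w @ [x]) k (length w) \<and> k < length w \<and> x < w ! k"
    proof cases
      case 1
      then obtain k where k: "k < length w" "w ! k = 1" "cnt w 1 k = s"
        using cnt_surj[of "length w" w s 1] by (auto simp: cnt_length q_def)
      then show ?thesis
        using 1 i nv[of i] len bv1[of s]
        by (intro exI[of _ k]) (simp add: cell_def nth_append cnt_length z_def)
    next
      case 2
      then obtain k where k: "k < length w" "w ! k = 2" "cnt w 2 k = s"
        using cnt_surj[of "length w" w s 2] by (auto simp: cnt_length t_def)
      then show ?thesis
        using 2 i nv[of i] len bv2[of s]
        by (intro exI[of _ k]) (simp add: cell_def nth_append cnt_length z_def q_def)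
    qed
  next
    fix k assume k: "k < length w" "x < w ! k"
    consider "w ! k = 1" | "w ! k = 2"
      using is_word_nth[OF w k(1)] k(2) by auto
    then show "\<exists>i. cell (w @ [x]) k (length w) = Tile (border_vertex v i) (v ! i) x \<and> i < length v \<and> x < v ! i"
    proof cases
      case 1
      then have "cnt w 1 k < q"
        using cnt_less[OF k(1) le_refl] by (simp add: cnt_length q_def)
      then show ?thesis
        using 1 k nv[of "z + cnt w 1 k"] len bv1[of "cnt w 1 k"]
        by (intro exI[of _ "z + cnt w 1 k"]) (simp add: cell_def nth_append cnt_length z_def)
    next
      case 2
      then have "cnt w 2 k < t"
        using cnt_less[OF k(1) le_refl] by (simp add: cnt_length t_def)
      then show ?thesis
        using 2 k nv[of "z + q + cnt w 2 k"] len bv2[of "cnt w 2 k"]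
        by (intro exI[of _ "z + q + cnt w 2 k"]) (simp add: cell_def nth_append cnt_length z_def q_def)
    qed
  qed
  finally show ?thesis .
qed

text \<open>Appending a letter adds exactly the inversions that end in it, which are the new tiles;
  old cells stay since \<open>cell w i j\<close> refers to the word only up to position
  \<open>j\<close>.\<close>

lemma tiling_eq: "is_word w \<Longrightarrow> tiling w = {cell w i j |i j. inversion w i j}"
proof (induction w rule: rev_induct)
  case Nil
  show ?case by (simp add: tiling_sorted inversion_def)
next
  case (snoc x w)
  have old: "inversion w i j \<Longrightarrow> cell (w @ [x]) i j = cell w i j" for i j
    by (simp add: inversion_def)
  have "{cell (w @ [x]) i j |i j. inversion (w @ [x]) i j} =
      {cell w i j |i j. inversion w i j} \<union> {cell (w @ [x]) i (length w) |i. i < length w \<and> x < w ! i}"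
    using old by (force simp: inversion_snoc)
  then show ?case
    using snoc tiling_snoc[of w x] tiling_sort_snoc[of w x] by simp
qed

section \<open>Strips\<close>

text \<open>Both letters can be read off a tile. In a row, the first coordinate counts the letters 0
  and 1 before \<open>j\<close>; as \<open>j\<close> is such a letter, this fixes \<open>j\<close>,
  and the second coordinate then fixes \<open>i\<close>. In a short rhombus the second coordinate
  fixes \<open>i\<close>, and the first one then \<open>j\<close>.\<close>

lemma cell_inj:
  assumes w: "is_word w" and "inversion w i j" "inversion w i' j'" "cell w i j = cell w i' j'"
  shows "i = i' \<and> j = j'"
proof -
  have len: "i < length w" "j < length w" "i' < length w" "j' < length w"
    using assms(2,3) by (auto simp: inversion_def)
  have eq: "w ! i = w ! i'" "w ! j = w ! j'"
    using assms(4) by (auto simp: cell_def)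
  show ?thesis
  proof (cases "w ! i = 2")
    case True
    then have j2: "w ! j < 2"
      using assms(2) by (auto simp: inversion_def)
    have off: "cnt w 0 j + cnt w 1 j = cnt w 0 j' + cnt w 1 j'"
      and y: "cnt w 1 j + cnt w 2 i = cnt w 1 j' + cnt w 2 i'"
      using assms(4) True eq by (auto simp: cell_def)
    have "j = j'"
    proof (cases rule: linorder_cases[of j j'])
      case less
      then show ?thesis
        using cnt_less[of j j' w "w ! j"] cnt_mono[of j j' w 0] cnt_mono[of j j' w 1] len j2 off
          is_word_nth[OF w len(2)] by auto
    next
      case greater
      then show ?thesis
        using cnt_less[of j' j w "w ! j"] cnt_mono[of j' j w 0] cnt_mono[of j' j w 1] len j2 off eq
          is_word_nth[OF w len(2)] by auto
    qed
    with y True show ?thesis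
      using cnt_inj[of i w i' 2] len eq by auto
  next
    case False
    then have "w ! i = 1" "w ! j = 0"
      using is_word_nth[OF w len(1)] assms(2) by (auto simp: inversion_def)
    then show ?thesis
      using assms(4) eq len cnt_inj[of i w i' 1] cnt_inj[of j w j' 0] by (auto simp: cell_def)
  qed
qed

text \<open>A strip given by ranked pairs: \<open>lab\<close> names the strip and \<open>rk\<close> counts the tiles before a tile.\<close>

locale chains =
  fixes A :: "'p set" and c :: "'p \<Rightarrow> 'b" and lab :: "'p \<Rightarrow> nat" and rk :: "'p \<Rightarrow> nat"
    and r :: "('b \<times> 'b) set"
  assumes inj: "inj_on c A"
    and r_eq: "r = {(c p, c q) |p q. p \<in> A \<and> q \<in> A \<and> lab p = lab q \<and> rk q = Suc (rk p)}"
    and pred: "\<And>q. q \<in> A \<Longrightarrow> 0 < rk q \<Longrightarrow> \<exists>p\<in>A. lab p = lab q \<and> Suc (rk p) = rk q"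
begin

lemma trancl_imp: "(x, y) \<in> r\<^sup>+ \<Longrightarrow> \<exists>p\<in>A. \<exists>q\<in>A. x = c p \<and> y = c q \<and> lab p = lab q \<and> rk p < rk q"
proof (induction rule: trancl_induct)
  case (base y)
  then show ?case by (auto simp: r_eq) (metis lessI)
next
  case (step y z)
  then obtain p q q' q'' where "p \<in> A" "q \<in> A" "x = c p" "y = c q" "lab p = lab q" "rk p < rk q"
    "y = c q'" "z = c q''" "q' \<in> A" "q'' \<in> A" "lab q' = lab q''" "rk q'' = Suc (rk q')"
    by (auto simp: r_eq)
  moreover from this have "q = q'"
    using inj by (auto dest: inj_onD)
  ultimately show ?case
    by (metis less_SucI)
qed

lemma imp_trancl: "p \<in> A \<Longrightarrow> q \<in> A \<Longrightarrow> lab p = lab q \<Longrightarrow> rk p < rk q \<Longrightarrow> (c p, c q) \<in> r\<^sup>+"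
proof (induction "rk q" arbitrary: q)
  case (Suc m)
  then obtain q' where q': "q' \<in> A" "lab q' = lab q" "Suc (rk q') = rk q"
    using pred[of q] by auto
  have step: "(c q', c q) \<in> r"
    using q' Suc.prems by (auto simp: r_eq) metis
  show ?case
  \<comment> \<open>Equal labels and ranks do not identify \<open>p\<close> with \<open>q'\<close>,
    but \<open>r_eq\<close> then links \<open>p\<close> itself to \<open>q\<close>.\<close>
  proof (cases "rk p = rk q'")
    case True
    then have "(c p, c q) \<in> r"
      using q' Suc.prems by (auto simp: r_eq) metis
    then show ?thesis by blast
  next
    case False
    then have "(c p, c q') \<in> r\<^sup>+"
      using Suc.hyps(2) Suc.prems q' by (intro Suc.hyps(1)) auto
    then show ?thesis
      using step by (rule trancl_into_trancl)
  qed
qed simp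

lemma trancl_iff: "p \<in> A \<Longrightarrow> q \<in> A \<Longrightarrow> (c p, c q) \<in> r\<^sup>+ \<longleftrightarrow> lab p = lab q \<and> rk p < rk q"
  using trancl_imp[of "c p" "c q"] imp_trancl[of p q] inj by (auto dest: inj_onD)

text \<open>Predecessors lead from any tile of the label \<open>d\<close> back to one of rank 0, and
  steps of \<open>r\<close> never leave the label.\<close>

lemma reach_eq: "{u. \<exists>p\<in>A. lab p = d \<and> rk p = 0 \<and> (c p, u) \<in> r\<^sup>*} = c ` {p\<in>A. lab p = d}"
proof (intro equalityI subsetI)
  fix u assume "u \<in> {u. \<exists>p\<in>A. lab p = d \<and> rk p = 0 \<and> (c p, u) \<in> r\<^sup>*}"
  then obtain p where p: "p \<in> A" "lab p = d" "(c p, u) \<in> r\<^sup>*"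
    by auto
  show "u \<in> c ` {p\<in>A. lab p = d}"
  proof (cases "c p = u")
    case False
    then have "(c p, u) \<in> r\<^sup>+"
      using p(3) by (auto dest: rtranclD)
    from trancl_imp[OF this] show ?thesis
      using p inj by (auto dest: inj_onD)
  qed (use p in auto)
next
  fix u assume "u \<in> c ` {p\<in>A. lab p = d}"
  then obtain q where q: "q \<in> A" "lab q = d" "u = c q"
    by auto
  have "\<exists>p\<in>A. lab p = lab q \<and> rk p = 0 \<and> (c p, c q) \<in> r\<^sup>*"
    using q(1)
  proof (induction "rk q" arbitrary: q)
    case (Suc m)
    then obtain q' where q': "q' \<in> A" "lab q' = lab q" "Suc (rk q') = rk q"
      using pred[of q] by auto
    then obtain p where "p \<in> A" "lab p = lab q'" "rk p = 0" "(c p, c q') \<in> r\<^sup>*"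
      using Suc.hyps by force
    moreover have "(c q', c q) \<in> r"
      using q' Suc.prems by (auto simp: r_eq) metis
    ultimately show ?case
      using q'(2) by (metis rtrancl.rtrancl_into_rtrancl)
  qed auto
  then show "u \<in> {u. \<exists>p\<in>A. lab p = d \<and> rk p = 0 \<and> (c p, u) \<in> r\<^sup>*}"
    using q by auto
qed

end

text \<open>The common frame for the three kinds of strips, with \<open>k\<close> the letter of the
  connecting edges: \<open>act\<close> marks the cells with sides of that letter, and
  \<open>ein\<close> and \<open>eout\<close> are the starting points of these sides on the southeast
  and on the northwest of the cell. The assumptions express shared sides by \<open>lab\<close> and
  \<open>rk\<close>, which turns strips into chains.\<close>

locale strips =
  fixes w :: "nat list" and k :: nat and act :: "nat \<Rightarrow> nat \<Rightarrow> bool"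
    and ein eout :: "nat \<Rightarrow> nat \<Rightarrow> point" and lab rk :: "nat \<Rightarrow> nat \<Rightarrow> nat"
  assumes word: "is_word w"
    and crosses_cell: "\<And>i j p e'. inversion w i j \<Longrightarrow>
      crosses (cell w i j) (p, k) e' \<longleftrightarrow> act i j \<and> p = ein i j \<and> e' = (eout i j, k)"
    and link: "\<And>i j i' j'. inversion w i j \<Longrightarrow> act i j \<Longrightarrow> inversion w i' j' \<Longrightarrow> act i' j' \<Longrightarrow>
      eout i j = ein i' j' \<longleftrightarrow> lab i j = lab i' j' \<and> rk i' j' = Suc (rk i j)"
    and start: "\<And>d i j. d < length w \<Longrightarrow> w ! d = k \<Longrightarrow> inversion w i j \<Longrightarrow> act i j \<Longrightarrow>
      border_vertex w d = ein i j \<longleftrightarrow> lab i j = d \<and> rk i j = 0"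
    and pred: "\<And>i j. inversion w i j \<Longrightarrow> act i j \<Longrightarrow> 0 < rk i j \<Longrightarrow>
      \<exists>i' j'. inversion w i' j' \<and> act i' j' \<and> lab i' j' = lab i j \<and> Suc (rk i' j') = rk i j"
begin

sublocale chains "{(i, j). inversion w i j \<and> act i j}" "\<lambda>(i, j). cell w i j" "\<lambda>(i, j). lab i j"
  "\<lambda>(i, j). rk i j" "next_tile w k"
proof
  show "inj_on (\<lambda>(i, j). cell w i j) {(i, j). inversion w i j \<and> act i j}"
    using cell_inj[OF word] by (auto simp only: inj_on_def split_paired_all prod.case mem_Collect_eq)
  have crosses_letter: "snd e = snd e'" if "crosses t e e'" for t e e'
    using that by (cases t) auto
  \<comment> \<open>\<open>crosses_cell\<close> starts from a southeast side of letter
    \<open>k\<close>; here the northwest side is given, and the parallel southeast side carries the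
    same letter.\<close>
  have crosses_cell': "(\<exists>e. crosses (cell w i j) e (p, k)) \<longleftrightarrow> act i j \<and> p = eout i j"
    if "inversion w i j" for i j p
  proof
    assume "\<exists>e. crosses (cell w i j) e (p, k)"
    then obtain q l where e: "crosses (cell w i j) (q, l) (p, k)"
      by auto
    with crosses_letter[OF this] show "act i j \<and> p = eout i j"
      by (simp add: crosses_cell[OF that])
  qed (use crosses_cell[OF that] in blast)
  have "next_tile w k = {(cell w i j, cell w i' j') |i j i' j'. inversion w i j \<and> act i j \<and>
      inversion w i' j' \<and> act i' j' \<and> eout i j = ein i' j'}"
    (is "_ = ?S")
  proof (rule set_eqI, clarify)
    fix t u
    have "(t, u) \<in> next_tile w k \<longleftrightarrow> (\<exists>i j i' j'. t = cell w i j \<and> u = cell w i' j' \<and> inversion w i j \<and>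
        inversion w i' j' \<and> (\<exists>p e e'. crosses (cell w i j) e (p, k) \<and> crosses (cell w i' j') (p, k) e'))"
      unfolding next_tile_def tiling_eq[OF word] by blast
    also have "\<dots> \<longleftrightarrow> (t, u) \<in> ?S"
      using crosses_cell' by (simp add: crosses_cell cong: conj_cong) blast
    finally show "(t, u) \<in> next_tile w k \<longleftrightarrow> (t, u) \<in> ?S" .
  qed
  also have "\<dots> = {(cell w i j, cell w i' j') |i j i' j'. inversion w i j \<and> act i j \<and>
      inversion w i' j' \<and> act i' j' \<and> lab i j = lab i' j' \<and> rk i' j' = Suc (rk i j)}"
    using link by blast
  finally show "next_tile w k = {((case p of (i, j) \<Rightarrow> cell w i j), (case q of (i, j) \<Rightarrow> cell w i j)) |p q.
      p \<in> {(i, j). inversion w i j \<and> act i j} \<and> q \<in> {(i, j). inversion w i j \<and> act i j} \<and>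
      (case p of (i, j) \<Rightarrow> lab i j) = (case q of (i, j) \<Rightarrow> lab i j) \<and>
      (case q of (i, j) \<Rightarrow> rk i j) = Suc (case p of (i, j) \<Rightarrow> rk i j)}"
    by auto
  show "\<exists>p\<in>{(i, j). inversion w i j \<and> act i j}. (case p of (i, j) \<Rightarrow> lab i j) = (case q of (i, j) \<Rightarrow> lab i j) \<and>
      Suc (case p of (i, j) \<Rightarrow> rk i j) = (case q of (i, j) \<Rightarrow> rk i j)"
    if "q \<in> {(i, j). inversion w i j \<and> act i j}" "0 < (case q of (i, j) \<Rightarrow> rk i j)" for q
    using that pred by (cases q) fastforce
qed

lemma next_tile_trancl:
  "inversion w i j \<Longrightarrow> inversion w i' j' \<Longrightarrow>
    (cell w i j, cell w i' j') \<in> (next_tile w k)\<^sup>+ \<longleftrightarrow>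
    act i j \<and> act i' j' \<and> lab i j = lab i' j' \<and> rk i j < rk i' j'"
  using trancl_iff[of "(i, j)" "(i', j')"] trancl_imp[of "cell w i j" "cell w i' j'"]
  by (auto dest: cell_inj[OF word])

lemma strip_eq:
  assumes d: "d < length w" "w ! d = k"
  shows "strip w d = {cell w i j |i j. inversion w i j \<and> act i j \<and> lab i j = d}"
proof -
  have "(\<exists>e'. crosses (cell w i j) (border_edge w d) e') \<longleftrightarrow> act i j \<and> lab i j = d \<and> rk i j = 0"
    if "inversion w i j" for i j
    using crosses_cell[OF that] start[OF d that] d(2) by (auto simp: border_edge_def)
  then have "strip w d = {u. \<exists>p\<in>{(i, j). inversion w i j \<and> act i j}. (case p of (i, j) \<Rightarrow> lab i j) = d \<and>
      (case p of (i, j) \<Rightarrow> rk i j) = 0 \<and> ((case p of (i, j) \<Rightarrow> cell w i j), u) \<in> (next_tile w k)\<^sup>*}"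
    unfolding strip_def tiling_eq[OF word] d(2) by fastforce
  also have "\<dots> = {cell w i j |i j. inversion w i j \<and> act i j \<and> lab i j = d}"
    unfolding reach_eq by auto
  finally show ?thesis .
qed

end

text \<open>The cases are the tall rhombus, the square and the short rhombus.\<close>

lemma inversion_letters:
  assumes "is_word w" "inversion w i j"
  obtains "w ! i = 2" "w ! j = 1" | "w ! i = 2" "w ! j = 0" | "w ! i = 1" "w ! j = 0"
  using assms is_word_nth[of w i] is_word_nth[of w j] by (auto simp: inversion_def)

text \<open>The edges met by a strip. The vertical strip \<open>i\<close> is followed through the letters \<open>t \<ge> i\<close>, the
  horizontal strip \<open>j\<close> through decreasing height \<open>y\<close>, the diagonal strip \<open>d\<close> through its \<open>m\<close>-th edge.\<close>

definition row_edge :: "nat list \<Rightarrow> nat \<Rightarrow> nat \<Rightarrow> point" where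
  "row_edge w i t = (- int (cnt w 0 t + cnt w 1 t), - int (cnt w 1 t + cnt w 2 i))"

definition col_edge :: "nat list \<Rightarrow> nat \<Rightarrow> nat \<Rightarrow> point" where
  "col_edge w j y = (- int (cnt w 0 j + min y (cnt w 1 j)), - int y)"

definition diag_edge :: "nat list \<Rightarrow> nat \<Rightarrow> nat \<Rightarrow> point" where
  "diag_edge w d m = (- int (cnt w 0 d + cnt w 1 d + (m - cnt w 2 d)), - int (cnt w 1 d + (cnt w 2 d - m)))"

text \<open>The first coordinate fixes the sum of two counts that are both monotone in
  \<open>t\<close>, so it fixes each of them; the second coordinate then fixes
  \<open>cnt w 2 i\<close>.\<close>

lemma row_edge_eq_iff:
  assumes "i < length w" "i' < length w" "w ! i = 2" "w ! i' = 2"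
  shows "row_edge w i t = row_edge w i' t' \<longleftrightarrow> i = i' \<and> cnt w 0 t + cnt w 1 t = cnt w 0 t' + cnt w 1 t'"
proof -
  have "cnt w 1 t = cnt w 1 t'" if "cnt w 0 t + cnt w 1 t = cnt w 0 t' + cnt w 1 t'"
    using that cnt_mono[of t t' w 0] cnt_mono[of t t' w 1] cnt_mono[of t' t w 0] cnt_mono[of t' t w 1]
    by linarith
  then show ?thesis
    using cnt_inj[of i w i' 2] assms by (auto simp: row_edge_def)
qed

text \<open>Crossing a row moves the edge of a column straight up, crossing a diagonal strip moves
  it by \<open>(1, 1)\<close>; the \<open>min\<close> switches between the two. At equal height, a
  later column lies strictly further west.\<close>

lemma col_edge_eq_iff:
  assumes "j < length w" "j' < length w" "w ! j = 0" "w ! j' = 0"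
  shows "col_edge w j y = col_edge w j' y' \<longleftrightarrow> j = j' \<and> y = y'"
  using assms cnt_less[of j j' w 0] cnt_less[of j' j w 0] cnt_mono[of j j' w 1] cnt_mono[of j' j w 1]
  by (cases rule: linorder_cases[of j j']) (auto simp: col_edge_def min_def split: if_splits)

text \<open>The truncated differences encode two phases: the edge goes up through the rows, then
  west through the columns. For \<open>d < d'\<close>, equal height would force the edge of
  \<open>d\<close> to be in its first phase still, where it lies too far east.\<close>

lemma diag_edge_eq_iff:
  assumes "d < length w" "d' < length w" "w ! d = 1" "w ! d' = 1"
  shows "diag_edge w d m = diag_edge w d' m' \<longleftrightarrow> d = d' \<and> m = m'"
  using assms cnt_less[of d d' w 1] cnt_less[of d' d w 1] cnt_mono[of d d' w 0] cnt_mono[of d' d w 0]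
  by (cases rule: linorder_cases[of d d']) (auto simp: diag_edge_def)

text \<open>The number of strips that the column \<open>j\<close> has yet to cross beyond the cell:
  the earlier rows and all diagonal strips, or only the earlier diagonal strips.\<close>

definition col_height :: "nat list \<Rightarrow> nat \<Rightarrow> nat \<Rightarrow> nat" where
  "col_height w i j = (if w ! i = 2 then cnt w 1 j + cnt w 2 i else cnt w 1 i)"

definition diag_index :: "nat list \<Rightarrow> nat \<Rightarrow> nat \<Rightarrow> nat" where
  "diag_index w i j = (if w ! i = 2 then j else i)"

text \<open>A diagonal strip crosses the rows before it from the last to the first, hence the
  \<open>- 1\<close>, and then the columns after it from the first to the last.\<close>

definition diag_rank :: "nat list \<Rightarrow> nat \<Rightarrow> nat \<Rightarrow> nat" where
  "diag_rank w i j =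
    (if w ! i = 2 then cnt w 2 j - 1 - cnt w 2 i else cnt w 2 i + (cnt w 0 j - cnt w 0 i))"

text \<open>A row crosses the later letters 0 and 1 in the order of the word, so the rank counts
  those between \<open>i\<close> and \<open>j\<close>.\<close>

lemma row_strips:
  assumes w: "is_word w"
  shows "strips w 2 (\<lambda>i j. w ! i = 2) (\<lambda>i j. row_edge w i j) (\<lambda>i j. row_edge w i (Suc j)) (\<lambda>i j. i)
    (\<lambda>i j. (cnt w 0 j + cnt w 1 j) - (cnt w 0 i + cnt w 1 i))"
proof
  show "is_word w" by fact
  have Suc_off: "cnt w 0 (Suc j) + cnt w 1 (Suc j) = Suc (cnt w 0 j + cnt w 1 j)"
    if "inversion w i j" for i j
    using w that that[unfolded inversion_def] by (cases rule: inversion_letters) (auto simp: cnt_Suc)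
  have le: "cnt w 0 i + cnt w 1 i \<le> cnt w 0 j + cnt w 1 j" if "inversion w i j" for i j
    using that cnt_mono[of i j w] by (auto simp: inversion_def add_mono)
  show "crosses (cell w i j) (p, 2) e' \<longleftrightarrow> w ! i = 2 \<and> p = row_edge w i j \<and> e' = (row_edge w i (Suc j), 2)"
    if "inversion w i j" for i j p e'
    using w that that[unfolded inversion_def]
    by (cases rule: inversion_letters) (auto simp: cell_def row_edge_def step_def cnt_Suc)
  show "row_edge w i (Suc j) = row_edge w i' j' \<longleftrightarrow> i = i' \<and>
      (cnt w 0 j' + cnt w 1 j') - (cnt w 0 i' + cnt w 1 i') = Suc ((cnt w 0 j + cnt w 1 j) - (cnt w 0 i + cnt w 1 i))"
    if "inversion w i j" "w ! i = 2" "inversion w i' j'" "w ! i' = 2" for i j i' j'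
    using that row_edge_eq_iff[of i w i' "Suc j" j'] Suc_off[of i j] le[of i j] le[of i' j']
    by (auto simp: inversion_def)
  show "border_vertex w d = row_edge w i j \<longleftrightarrow> i = d \<and> (cnt w 0 j + cnt w 1 j) - (cnt w 0 i + cnt w 1 i) = 0"
    if "d < length w" "w ! d = 2" "inversion w i j" "w ! i = 2" for d i j
    using that row_edge_eq_iff[of d w i d j] le[of i j] border_vertex_eq[OF w, of d]
    by (auto simp: inversion_def row_edge_def)
  show "\<exists>i' j'. inversion w i' j' \<and> w ! i' = 2 \<and> i' = i \<and>
      Suc ((cnt w 0 j' + cnt w 1 j') - (cnt w 0 i' + cnt w 1 i')) = (cnt w 0 j + cnt w 1 j) - (cnt w 0 i + cnt w 1 i)"
    if ij: "inversion w i j" "w ! i = 2" "0 < (cnt w 0 j + cnt w 1 j) - (cnt w 0 i + cnt w 1 i)" for i j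
  proof -
    have "cnt w 0 j + cnt w 1 j - 1 < cnt w 0 j + cnt w 1 j"
      using ij(3) by linarith
    \<comment> \<open>This is the last letter 0 or 1 before \<open>j\<close>; the positive rank puts
      it after \<open>i\<close>.\<close>
    then obtain j' where j': "j' < j" "w ! j' < 2" "cnt w 0 j' + cnt w 1 j' = cnt w 0 j + cnt w 1 j - 1"
      using off_surj[of j w "cnt w 0 j + cnt w 1 j - 1"] ij by (auto simp: inversion_def)
    have "i < j'"
    proof (rule ccontr)
      assume "\<not> i < j'"
      with j' ij have "j' < i" "i < length w" "w ! j' = 0 \<or> w ! j' = 1"
        by (auto simp: inversion_def intro: le_neq_implies_less)
      then show False
        using ij(3) j'(3) cnt_less[of j' i w "w ! j'"] cnt_mono[of j' i w 0] cnt_mono[of j' i w 1] by auto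
    qed
    then show ?thesis
      using ij j' by (intro exI[of _ i] exI[of _ j']) (auto simp: inversion_def)
  qed
qed

text \<open>Each crossing lowers the height of the edge by one, starting from
  \<open>cnt w 1 j + cnt w 2 j\<close> at the border. A cell is entered one above the height
  \<open>col_height\<close> at which it is left, hence the \<open>Suc\<close>.\<close>

lemma col_strips:
  assumes w: "is_word w"
  shows "strips w 0 (\<lambda>i j. w ! j = 0) (\<lambda>i j. col_edge w j (Suc (col_height w i j)))
    (\<lambda>i j. col_edge w j (col_height w i j)) (\<lambda>i j. j)
    (\<lambda>i j. cnt w 1 j + cnt w 2 j - Suc (col_height w i j))"
proof
  show "is_word w" by fact
  have less: "col_height w i j < cnt w 1 j + cnt w 2 j" if "inversion w i j" "w ! j = 0" for i j
    using w that(1) that[unfolded inversion_def] cnt_less[of i j w 2] cnt_less[of i j w 1]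
    by (cases rule: inversion_letters) (auto simp: col_height_def)
  have less1: "cnt w 1 i < cnt w 1 j" if "inversion w i j" "w ! i = 1" for i j
    using that[unfolded inversion_def] cnt_less[of i j w 1] by auto
  show "crosses (cell w i j) (p, 0) e' \<longleftrightarrow> w ! j = 0 \<and> p = col_edge w j (Suc (col_height w i j)) \<and>
      e' = (col_edge w j (col_height w i j), 0)"
    if "inversion w i j" for i j p e'
    using w that that[unfolded inversion_def] less1[OF that]
    by (cases rule: inversion_letters) (auto simp: cell_def col_edge_def col_height_def step_def)
  show "col_edge w j (col_height w i j) = col_edge w j' (Suc (col_height w i' j')) \<longleftrightarrow> j = j' \<and>
      cnt w 1 j' + cnt w 2 j' - Suc (col_height w i' j') = Suc (cnt w 1 j + cnt w 2 j - Suc (col_height w i j))"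
    if "inversion w i j" "w ! j = 0" "inversion w i' j'" "w ! j' = 0" for i j i' j'
    using that less[of i j] less[of i' j'] col_edge_eq_iff[of j w j' "col_height w i j" "Suc (col_height w i' j')"]
    by (auto simp: inversion_def)
  show "border_vertex w d = col_edge w j (Suc (col_height w i j)) \<longleftrightarrow>
      j = d \<and> cnt w 1 j + cnt w 2 j - Suc (col_height w i j) = 0"
    if "d < length w" "w ! d = 0" "inversion w i j" "w ! j = 0" for d i j
  proof -
    have "border_vertex w d = col_edge w d (cnt w 1 d + cnt w 2 d)"
      using border_vertex_eq[OF w, of d] that by (simp add: col_edge_def)
    then show ?thesis
      using that less[of i j] col_edge_eq_iff[of d w j "cnt w 1 d + cnt w 2 d" "Suc (col_height w i j)"]
      by (auto simp: inversion_def)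
  qed
  show "\<exists>i' j'. inversion w i' j' \<and> w ! j' = 0 \<and> j' = j \<and>
      Suc (cnt w 1 j' + cnt w 2 j' - Suc (col_height w i' j')) = cnt w 1 j + cnt w 2 j - Suc (col_height w i j)"
    if ij: "inversion w i j" "w ! j = 0" "0 < cnt w 1 j + cnt w 2 j - Suc (col_height w i j)" for i j
  proof -
    define y where "y = Suc (col_height w i j)"
    have y: "y < cnt w 1 j + cnt w 2 j"
      using ij by (simp add: y_def)
    \<comment> \<open>The preceding cell is the one left at height \<open>y\<close>: it lies in a
      diagonal strip if \<open>y < cnt w 1 j\<close>, otherwise in a row.\<close>
    obtain i' where i': "i' < j" "0 < w ! i'" "col_height w i' j = y"
    proof (cases "y < cnt w 1 j")
      case True
      then obtain i' where "i' < j" "w ! i' = 1" "cnt w 1 i' = y"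
        using cnt_surj[of j w y 1] ij by (auto simp: inversion_def)
      then show ?thesis
        using that[of i'] by (simp add: col_height_def)
    next
      case False
      then have "y - cnt w 1 j < cnt w 2 j"
        using y by linarith
      then obtain i' where "i' < j" "w ! i' = 2" "cnt w 2 i' = y - cnt w 1 j"
        using cnt_surj[of j w "y - cnt w 1 j" 2] ij by (auto simp: inversion_def)
      then show ?thesis
        using that[of i'] False by (simp add: col_height_def)
    qed
    show ?thesis
      using ij i' y by (intro exI[of _ i'] exI[of _ j]) (auto simp: inversion_def y_def)
  qed
qed

lemma diag_strips:
  assumes w: "is_word w"
  shows "strips w 1 (\<lambda>i j. w ! i = 1 \<or> w ! j = 1) (\<lambda>i j. diag_edge w (diag_index w i j) (diag_rank w i j))
    (\<lambda>i j. diag_edge w (diag_index w i j) (Suc (diag_rank w i j))) (diag_index w) (diag_rank w)"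
proof
  show "is_word w" by fact
  have less: "cnt w 2 i < cnt w 2 j" if "inversion w i j" "w ! i = 2" for i j
    using that[unfolded inversion_def] cnt_less[of i j w 2] by auto
  have le: "cnt w a i \<le> cnt w a j" if "inversion w i j" for i j a
    using that[unfolded inversion_def] cnt_mono[of i j w] by auto
  have idx: "diag_index w i j < length w \<and> w ! diag_index w i j = 1"
    if "inversion w i j" "w ! i = 1 \<or> w ! j = 1" for i j
    using w that(1) that[unfolded inversion_def] by (cases rule: inversion_letters) (auto simp: diag_index_def)
  show "crosses (cell w i j) (p, 1) e' \<longleftrightarrow> (w ! i = 1 \<or> w ! j = 1) \<and>
      p = diag_edge w (diag_index w i j) (diag_rank w i j) \<and>
      e' = (diag_edge w (diag_index w i j) (Suc (diag_rank w i j)), 1)"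
    if "inversion w i j" for i j p e'
    using w that that[unfolded inversion_def] less[OF that] le[OF that, of 0]
    by (cases rule: inversion_letters)
      (auto simp: cell_def diag_edge_def diag_index_def diag_rank_def step_def)
  show "diag_edge w (diag_index w i j) (Suc (diag_rank w i j)) = diag_edge w (diag_index w i' j') (diag_rank w i' j') \<longleftrightarrow>
      diag_index w i j = diag_index w i' j' \<and> diag_rank w i' j' = Suc (diag_rank w i j)"
    if "inversion w i j" "w ! i = 1 \<or> w ! j = 1" "inversion w i' j'" "w ! i' = 1 \<or> w ! j' = 1" for i j i' j'
    using idx[of i j] idx[of i' j'] that by (auto simp: diag_edge_eq_iff)
  show "border_vertex w d = diag_edge w (diag_index w i j) (diag_rank w i j) \<longleftrightarrow>
      diag_index w i j = d \<and> diag_rank w i j = 0"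
    if "d < length w" "w ! d = 1" "inversion w i j" "w ! i = 1 \<or> w ! j = 1" for d i j
  proof -
    have "border_vertex w d = diag_edge w d 0"
      using border_vertex_eq[OF w, of d] that by (simp add: diag_edge_def)
    then show ?thesis
      using that idx[of i j] by (auto simp: diag_edge_eq_iff)
  qed
  show "\<exists>i' j'. inversion w i' j' \<and> (w ! i' = 1 \<or> w ! j' = 1) \<and> diag_index w i' j' = diag_index w i j \<and>
      Suc (diag_rank w i' j') = diag_rank w i j"
    if ij: "inversion w i j" "w ! i = 1 \<or> w ! j = 1" "0 < diag_rank w i j" for i j
  proof -
    define d m where "d = diag_index w i j" and "m = diag_rank w i j - 1"
    have d: "d < length w" "w ! d = 1" and m: "diag_rank w i j = Suc m"
      using idx[OF ij(1,2)] ij(3) by (auto simp: d_def m_def)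
    have "\<exists>i' j'. inversion w i' j' \<and> (w ! i' = 1 \<or> w ! j' = 1) \<and> diag_index w i' j' = d \<and> diag_rank w i' j' = m"
    \<comment> \<open>The ranks below \<open>cnt w 2 d\<close> belong to rows, and at rank
      \<open>m\<close> there are \<open>m\<close> rows between the crossed row and \<open>d\<close>.
      Beyond them the predecessor lies in the preceding column.\<close>
    proof (cases "m < cnt w 2 d")
      case True
      then obtain i' where "i' < d" "w ! i' = 2" "cnt w 2 i' = cnt w 2 d - 1 - m"
        using cnt_surj[of d w "cnt w 2 d - 1 - m" 2] d by auto
      then show ?thesis
        using True d by (intro exI[of _ i'] exI[of _ d]) (auto simp: inversion_def diag_index_def diag_rank_def)
    next
      case False
      have "w ! i = 1 \<and> d = i \<and> w ! j = 0"
        using w ij(1) m False by (cases rule: inversion_letters) (auto simp: d_def diag_index_def diag_rank_def)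
      then have i: "w ! i = 1" "d = i" "w ! j = 0"
        by auto
      then have "cnt w 0 i + (m - cnt w 2 i) < cnt w 0 j"
        using m False by (auto simp: diag_rank_def)
      then obtain j' where j': "j' < j" "w ! j' = 0" "cnt w 0 j' = cnt w 0 i + (m - cnt w 2 i)"
        using cnt_surj[of j w "cnt w 0 i + (m - cnt w 2 i)" 0] ij by (auto simp: inversion_def)
      then have "i < j'"
        using cnt_less[of j' i w 0] d i by (cases rule: linorder_cases[of i j']) auto
      then show ?thesis
        using i j' ij False
        by (intro exI[of _ i] exI[of _ j']) (auto simp: inversion_def diag_index_def diag_rank_def)
    qed
    then show ?thesis
      using m d_def by auto
  qed
qed

text \<open>For an inversion that involves \<open>d\<close>, the letter of \<open>d\<close> already
  forces \<open>act\<close> and \<open>lab\<close>, so one description covers all three kinds of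
  strips.\<close>

lemma strip_word:
  assumes w: "is_word w" and d: "d < length w"
  shows "strip w d = {cell w i j |i j. inversion w i j \<and> (i = d \<or> j = d)}"
proof -
  consider "w ! d = 0" | "w ! d = 1" | "w ! d = 2"
    using is_word_nth[OF w d] by auto
  then show ?thesis
  proof cases
    case 1
    then have "w ! j = 0 \<and> j = d \<longleftrightarrow> i = d \<or> j = d" if "inversion w i j" for i j
      using that by (auto simp: inversion_def)
    then show ?thesis
      unfolding strips.strip_eq[OF col_strips[OF w] d 1] by blast
  next
    case 2
    have "(w ! i = 1 \<or> w ! j = 1) \<and> diag_index w i j = d \<longleftrightarrow> i = d \<or> j = d" if "inversion w i j" for i j
      using w that 2 by (cases rule: inversion_letters) (auto simp: diag_index_def)
    then show ?thesis
      unfolding strips.strip_eq[OF diag_strips[OF w] d 2] by blast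
  next
    case 3
    then have "w ! i = 2 \<and> i = d \<longleftrightarrow> i = d \<or> j = d" if "inversion w i j" for i j
      using that is_word_nth[OF w, of i] by (auto simp: inversion_def)
    then show ?thesis
      unfolding strips.strip_eq[OF row_strips[OF w] d 3] by blast
  qed
qed

lemma points_to_left:
  assumes w: "is_word w" and ij: "inversion w i j" "inversion w i' j'"
  shows "points_to w LeftArrow (cell w i j) (cell w i' j') \<longleftrightarrow> w ! i = 2 \<and> i' = i \<and> j < j'"
proof -
  have "cnt w 0 j + cnt w 1 j - (cnt w 0 i + cnt w 1 i) < cnt w 0 j' + cnt w 1 j' - (cnt w 0 i + cnt w 1 i) \<longleftrightarrow> j < j'"
    if "w ! i = 2" "i' = i"
  proof
    assume "j < j'"
    moreover have "w ! j = 0 \<or> w ! j = 1"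
      using w ij(1) by (cases rule: inversion_letters) auto
    ultimately have "cnt w 0 j + cnt w 1 j < cnt w 0 j' + cnt w 1 j'"
      using cnt_less[of j j' w "w ! j"] cnt_mono[of j j' w 0] cnt_mono[of j j' w 1] ij(2)
      by (auto simp: inversion_def)
    moreover have "cnt w 0 i + cnt w 1 i \<le> cnt w 0 j + cnt w 1 j"
      using ij(1) cnt_mono[of i j w] by (auto simp: inversion_def intro: add_mono)
    ultimately show "cnt w 0 j + cnt w 1 j - (cnt w 0 i + cnt w 1 i) < cnt w 0 j' + cnt w 1 j' - (cnt w 0 i + cnt w 1 i)"
      by linarith
  next
    assume "cnt w 0 j + cnt w 1 j - (cnt w 0 i + cnt w 1 i) < cnt w 0 j' + cnt w 1 j' - (cnt w 0 i + cnt w 1 i)"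
    then show "j < j'"
      using cnt_mono[of j' j w 0] cnt_mono[of j' j w 1] by linarith
  qed
  then show ?thesis
    using strips.next_tile_trancl[OF row_strips[OF w] ij] by auto
qed

text \<open>The order in which a column meets the other strips on its way to the northwest border:
  rows before diagonal strips, each kind from the last to the first.\<close>

definition later_in_column :: "nat list \<Rightarrow> nat \<Rightarrow> nat \<Rightarrow> bool" where
  "later_in_column w i' i \<longleftrightarrow> w ! i' < w ! i \<or> (w ! i' = w ! i \<and> i' < i)"

text \<open>The rank falls as \<open>col_height\<close> grows. In a column, rows have heights of at
  least \<open>cnt w 1 j\<close> and diagonal strips smaller ones, and within a kind the height
  follows the position.\<close>

lemma points_to_up:
  assumes w: "is_word w" and ij: "inversion w i j" "inversion w i' j'"
  shows "points_to w UpArrow (cell w i j) (cell w i' j') \<longleftrightarrow> w ! j = 0 \<and> j' = j \<and> later_in_column w i' i"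
proof -
  have "cnt w 1 j + cnt w 2 j - Suc (col_height w i j) < cnt w 1 j + cnt w 2 j - Suc (col_height w i' j) \<longleftrightarrow>
      later_in_column w i' i" if "w ! j = 0" "j' = j"
  proof -
    have len: "i < j" "i' < j" "j < length w"
      using ij that by (auto simp: inversion_def)
    have cnt_iff: "cnt w a i' < cnt w a i \<longleftrightarrow> i' < i" if "w ! i = a" "w ! i' = a" for a
      using cnt_less[of i' i w a] cnt_mono[of i i' w a] that len by (cases "i' < i") auto
    have letters: "w ! i = 1 \<or> w ! i = 2" "w ! i' = 1 \<or> w ! i' = 2"
      using w ij(1) ij(2) by (auto elim: inversion_letters)
    then have "cnt w 1 i < cnt w 1 j \<or> w ! i = 2" "cnt w 1 i' < cnt w 1 j \<or> w ! i' = 2"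
        "cnt w 2 i < cnt w 2 j \<or> w ! i = 1" "cnt w 2 i' < cnt w 2 j \<or> w ! i' = 1"
      using cnt_less[of i j w] cnt_less[of i' j w] len by auto
    then show ?thesis
      using letters cnt_iff[of 1] cnt_iff[of 2] by (auto simp: col_height_def later_in_column_def)
  qed
  then show ?thesis
    using strips.next_tile_trancl[OF col_strips[OF w] ij] ij by (auto simp: inversion_def later_in_column_def)
qed

section \<open>Tableaux as fillings of the inversions of a word\<close>

text \<open>The arrow rules in terms of positions alone, without tiles. Requiring
  \<open>None\<close> off the inversions makes the function unique for a given filling.\<close>

definition tableau :: "nat list \<Rightarrow> (nat \<Rightarrow> nat \<Rightarrow> arrow option) \<Rightarrow> bool" where
  "tableau w f \<longleftrightarrow> (\<forall>i j. f i j \<noteq> None \<longrightarrow> inversion w i j) \<and>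
     (\<forall>i j. f i j = Some LeftArrow \<longrightarrow> w ! i = 2 \<and> (\<forall>j'>j. f i j' = None)) \<and>
     (\<forall>i j. f i j = Some UpArrow \<longrightarrow> w ! j = 0 \<and> (\<forall>i'. later_in_column w i' i \<longrightarrow> f i' j = None))"

definition arrows :: "nat list \<Rightarrow> filling \<Rightarrow> nat \<Rightarrow> nat \<Rightarrow> arrow option" where
  "arrows w R i j = (if inversion w i j then R (cell w i j) else None)"

lemma is_RAT_iff:
  assumes w: "is_word w"
  shows "is_RAT w R \<longleftrightarrow> dom R \<subseteq> tiling w \<and> tableau w (arrows w R)"
proof -
  let ?f = "arrows w R"
  \<comment> \<open>Quantifiers over tiles with an arrow become quantifiers over pairs; by the
    domain condition no arrow lies elsewhere.\<close>
  have all_tiles: "(\<forall>t. R t \<noteq> None \<longrightarrow> P t) \<longleftrightarrow> (\<forall>i j. ?f i j \<noteq> None \<longrightarrow> P (cell w i j))"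
    if "dom R \<subseteq> tiling w" for P
    using that unfolding tiling_eq[OF w] by (auto simp: arrows_def)
  have strp: "(\<exists>d\<in>positions w a. cell w i j \<in> strip w d) \<longleftrightarrow> w ! i = a \<or> w ! j = a"
    if "inversion w i j" for i j a
  proof -
    have "cell w i j \<in> strip w d \<longleftrightarrow> i = d \<or> j = d" if "d \<in> positions w a" for d
      using that strip_word[OF w, of d] \<open>inversion w i j\<close> cell_inj[OF w]
      by (simp add: positions_def) blast
    moreover have "i < length w" "j < length w"
      using that by (auto simp: inversion_def)
    ultimately show ?thesis
      by (auto simp: positions_def)
  qed
  have up: "(\<forall>t. R t = Some UpArrow \<longrightarrow> (\<exists>i\<in>columns w. t \<in> strip w i)) \<longleftrightarrow>
      (\<forall>i j. ?f i j = Some UpArrow \<longrightarrow> w ! j = 0)" if d: "dom R \<subseteq> tiling w"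
  proof -
    have "(\<forall>t. R t = Some UpArrow \<longrightarrow> (\<exists>i\<in>columns w. t \<in> strip w i)) \<longleftrightarrow>
        (\<forall>t. R t \<noteq> None \<longrightarrow> R t = Some UpArrow \<longrightarrow> (\<exists>i\<in>columns w. t \<in> strip w i))"
      by auto
    also have "\<dots> \<longleftrightarrow> (\<forall>i j. ?f i j = Some UpArrow \<longrightarrow> w ! j = 0)"
      unfolding all_tiles[OF d] using strp by (auto simp: arrows_def inversion_def)
    finally show ?thesis .
  qed
  have left: "(\<forall>t. R t = Some LeftArrow \<longrightarrow> (\<exists>i\<in>rows w. t \<in> strip w i)) \<longleftrightarrow>
      (\<forall>i j. ?f i j = Some LeftArrow \<longrightarrow> w ! i = 2)" if d: "dom R \<subseteq> tiling w"
  proof -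
    \<comment> \<open>An inversion has its larger letter first, so a row can only be its first
      entry.\<close>
    have two: "w ! i = 2 \<or> w ! j = 2 \<longleftrightarrow> w ! i = 2" if "inversion w i j" for i j
      using that is_word_nth[OF w, of i] by (auto simp: inversion_def)
    have "(\<forall>t. R t = Some LeftArrow \<longrightarrow> (\<exists>i\<in>rows w. t \<in> strip w i)) \<longleftrightarrow>
        (\<forall>t. R t \<noteq> None \<longrightarrow> R t = Some LeftArrow \<longrightarrow> (\<exists>i\<in>rows w. t \<in> strip w i))"
      by auto
    also have "\<dots> \<longleftrightarrow> (\<forall>i j. ?f i j = Some LeftArrow \<longrightarrow> w ! i = 2)"
      unfolding all_tiles[OF d] using strp two by (auto simp: arrows_def)
    finally show ?thesis .
  qed
  have point: "(\<forall>t u a. R t = Some a \<and> points_to w a t u \<longrightarrow> R u = None) \<longleftrightarrow>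
      (\<forall>i j i' j' a. inversion w i j \<longrightarrow> inversion w i' j' \<longrightarrow> ?f i j = Some a \<longrightarrow>
        points_to w a (cell w i j) (cell w i' j') \<longrightarrow> ?f i' j' = None)" if d: "dom R \<subseteq> tiling w"
  proof -
    \<comment> \<open>Phrased for two tiles that both carry arrows, the rule has the form to which
      \<open>all_tiles\<close> applies twice.\<close>
    have "(\<forall>t u a. R t = Some a \<and> points_to w a t u \<longrightarrow> R u = None) \<longleftrightarrow>
        (\<forall>t. R t \<noteq> None \<longrightarrow> (\<forall>u. R u \<noteq> None \<longrightarrow> (\<forall>a. R t = Some a \<longrightarrow> \<not> points_to w a t u)))"
      by (metis option.distinct(1))
    also have "\<dots> \<longleftrightarrow> (\<forall>i j i' j' a. inversion w i j \<longrightarrow> inversion w i' j' \<longrightarrow> ?f i j = Some a \<longrightarrow>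
        points_to w a (cell w i j) (cell w i' j') \<longrightarrow> ?f i' j' = None)"
      unfolding all_tiles[OF d]
    proof (intro iffI allI impI)
      fix i j i' j' a
      assume H: "\<forall>i j. ?f i j \<noteq> None \<longrightarrow> (\<forall>i' j'. ?f i' j' \<noteq> None \<longrightarrow>
          (\<forall>a. R (cell w i j) = Some a \<longrightarrow> \<not> points_to w a (cell w i j) (cell w i' j')))"
        and inv: "inversion w i j" "inversion w i' j'" and a: "?f i j = Some a"
        and pt: "points_to w a (cell w i j) (cell w i' j')"
      have "R (cell w i j) = Some a"
        using inv a by (simp add: arrows_def)
      then show "?f i' j' = None"
        using H a pt by (metis option.distinct(1))
    next
      fix i j i' j' a
      assume H: "\<forall>i j i' j' a. inversion w i j \<longrightarrow> inversion w i' j' \<longrightarrow> ?f i j = Some a \<longrightarrow>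
          points_to w a (cell w i j) (cell w i' j') \<longrightarrow> ?f i' j' = None"
        and f: "?f i j \<noteq> None" "?f i' j' \<noteq> None" and a: "R (cell w i j) = Some a"
      have inv: "inversion w i j" "inversion w i' j'"
        using f by (simp_all add: arrows_def split: if_splits)
      then have "?f i j = Some a"
        using a by (simp add: arrows_def)
      then show "\<not> points_to w a (cell w i j) (cell w i' j')"
        using H[rule_format, OF inv] f(2) by metis
    qed
    finally show ?thesis .
  qed
  have arrow_rules: "(\<forall>i j i' j' a. inversion w i j \<longrightarrow> inversion w i' j' \<longrightarrow> ?f i j = Some a \<longrightarrow>
        points_to w a (cell w i j) (cell w i' j') \<longrightarrow> ?f i' j' = None) \<longleftrightarrow>
      (\<forall>i j. ?f i j = Some LeftArrow \<longrightarrow> w ! i = 2 \<longrightarrow> (\<forall>j'>j. ?f i j' = None)) \<and>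
      (\<forall>i j. ?f i j = Some UpArrow \<longrightarrow> w ! j = 0 \<longrightarrow> (\<forall>i'. later_in_column w i' i \<longrightarrow> ?f i' j = None))"
    (is "?A \<longleftrightarrow> ?B \<and> ?C")
  proof (intro iffI conjI)
    assume A: ?A
    show ?B
    proof (intro allI impI)
      fix i j j' assume f: "?f i j = Some LeftArrow" "w ! i = 2" "j < j'"
      show "?f i j' = None"
      proof (cases "inversion w i j'")
        case True
        have inv: "inversion w i j"
          using f(1) by (simp add: arrows_def split: if_splits)
        show ?thesis
          using A[rule_format, OF inv True f(1)] points_to_left[OF w inv True] f(2,3) by simp
      qed (simp add: arrows_def)
    qed
    show ?C
    proof (intro allI impI)
      fix i j i' assume f: "?f i j = Some UpArrow" "w ! j = 0" "later_in_column w i' i"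
      show "?f i' j = None"
      proof (cases "inversion w i' j")
        case True
        have inv: "inversion w i j"
          using f(1) by (simp add: arrows_def split: if_splits)
        show ?thesis
          using A[rule_format, OF inv True f(1)] points_to_up[OF w inv True] f(2,3) by simp
      qed (simp add: arrows_def)
    qed
  next
    assume BC: "?B \<and> ?C"
    show ?A
    proof (intro allI impI)
      fix i j i' j' a
      assume inv: "inversion w i j" "inversion w i' j'" and a: "?f i j = Some a"
        and pt: "points_to w a (cell w i j) (cell w i' j')"
      show "?f i' j' = None"
      proof (cases a)
        case UpArrow
        with pt have "w ! j = 0" "j' = j" "later_in_column w i' i"
          using points_to_up[OF w inv] by simp_all
        with BC a UpArrow show ?thesis
          by metis
      next
        case LeftArrow
        with pt have "w ! i = 2" "i' = i" "j < j'"
          using points_to_left[OF w inv] by simp_all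
        with BC a LeftArrow show ?thesis
          by metis
      qed
    qed
  qed
  have split: "(\<forall>i j. P i j \<longrightarrow> Q i j \<and> S i j) \<longleftrightarrow>
      (\<forall>i j. P i j \<longrightarrow> Q i j) \<and> (\<forall>i j. P i j \<longrightarrow> Q i j \<longrightarrow> S i j)" for P Q S :: "nat \<Rightarrow> nat \<Rightarrow> bool"
    by blast
  have inv: "\<forall>i j. ?f i j \<noteq> None \<longrightarrow> inversion w i j"
    by (simp add: arrows_def)
  show ?thesis
  proof (cases "dom R \<subseteq> tiling w")
    case True
    show ?thesis
      unfolding is_RAT_def tableau_def up[OF True] left[OF True] point[OF True] arrow_rules split
      by (insert True inv) (intro iffI conjI; elim conjE; assumption)
  qed (simp add: is_RAT_def)
qed

lemma tableau_inversion: "tableau w f \<Longrightarrow> f i j \<noteq> None \<Longrightarrow> inversion w i j"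
  unfolding tableau_def by blast

lemma tableau_left:
  assumes "tableau w f" "f i j = Some LeftArrow"
  shows "w ! i = 2" "j < j' \<Longrightarrow> f i j' = None"
  using assms unfolding tableau_def by metis+

lemma tableau_up:
  assumes "tableau w f" "f i j = Some UpArrow"
  shows "w ! j = 0" "later_in_column w i' i \<Longrightarrow> f i' j = None"
  using assms unfolding tableau_def by metis+

lemma tableauI:
  assumes "\<And>i j. f i j \<noteq> None \<Longrightarrow> inversion w i j"
    and "\<And>i j. f i j = Some LeftArrow \<Longrightarrow> w ! i = 2"
    and "\<And>i j j'. f i j = Some LeftArrow \<Longrightarrow> j < j' \<Longrightarrow> f i j' \<noteq> None \<Longrightarrow> False"
    and "\<And>i j. f i j = Some UpArrow \<Longrightarrow> w ! j = 0"
    and "\<And>i j i'. f i j = Some UpArrow \<Longrightarrow> later_in_column w i' i \<Longrightarrow> f i' j \<noteq> None \<Longrightarrow> False"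
  shows "tableau w f"
  unfolding tableau_def
proof (intro conjI allI impI)
  fix i j j' assume "f i j = Some LeftArrow" "j < j'"
  then show "f i j' = None"
    using assms(3)[of i j j'] by (cases "f i j'") simp_all
next
  fix i j i' assume "f i j = Some UpArrow" "later_in_column w i' i"
  then show "f i' j = None"
    using assms(5)[of i j i'] by (cases "f i' j") simp_all
qed (use assms in simp_all)

section \<open>The statistics and the weight of a tableau in terms of positions\<close>

definition free_rows :: "nat list \<Rightarrow> (nat \<Rightarrow> nat \<Rightarrow> arrow option) \<Rightarrow> nat set" where
  "free_rows w f = {i \<in> rows w. \<forall>j. f i j \<noteq> Some LeftArrow}"

definition free_cols :: "nat list \<Rightarrow> (nat \<Rightarrow> nat \<Rightarrow> arrow option) \<Rightarrow> nat set" where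
  "free_cols w f = {j \<in> columns w. \<forall>i. f i j \<noteq> Some UpArrow}"

definition diag_cells :: "nat \<Rightarrow> (nat \<Rightarrow> nat \<Rightarrow> arrow option) \<Rightarrow> (nat \<times> nat) set" where
  "diag_cells d f = {(i, j). (i = d \<or> j = d) \<and> f i j \<noteq> None}"

text \<open>\<open>Suc (cnt w 1 d)\<close> is the place of the diagonal strip \<open>d\<close> from
  the top, counted from 1.\<close>

definition weight :: "'a::comm_ring_1 \<Rightarrow> 'a \<Rightarrow> (nat \<Rightarrow> 'a) \<Rightarrow> nat list \<Rightarrow> (nat \<Rightarrow> nat \<Rightarrow> arrow option) \<Rightarrow> 'a" where
  "weight \<alpha> \<beta> z w f = \<alpha> ^ card (free_rows w f) * \<beta> ^ card (free_cols w f) *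
     (\<Prod>d\<in>diagonals w. z (Suc (cnt w 1 d)) ^ card (diag_cells d f))"

lemma finite_positions [simp]: "finite (positions w a)"
  by (simp add: positions_def)

lemma nth_filter_upt:
  "n \<le> length w \<Longrightarrow> length (filter (\<lambda>d. w ! d = a) [0..<n]) = cnt w a n \<and>
    (\<forall>k<cnt w a n. let d = filter (\<lambda>d. w ! d = a) [0..<n] ! k in d < n \<and> w ! d = a \<and> cnt w a d = k)"
proof (induction n)
  case (Suc n)
  then show ?case
    by (auto simp: cnt_Suc Let_def nth_append less_Suc_eq)
qed simp

lemma sorted_positions: "sorted_list_of_set (positions w a) = filter (\<lambda>d. w ! d = a) [0..<length w]"
  by (rule sorted_list_of_set_unique[THEN iffD1]) (auto simp: positions_def sorted_wrt_filter length_filter_conv_card cong: conj_cong)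

lemma nth_sorted_positions:
  assumes "k < count_list w a"
  shows "sorted_list_of_set (positions w a) ! k \<in> positions w a"
    and "cnt w a (sorted_list_of_set (positions w a) ! k) = k"
  using nth_filter_upt[of "length w" w a] assms
  unfolding sorted_positions by (auto simp: cnt_length Let_def positions_def)

lemma cnt_positions_less: "d \<in> positions w a \<Longrightarrow> cnt w a d < count_list w a"
  using cnt_less[of d "length w" w a] by (simp add: positions_def cnt_length)

lemma sorted_positions_nth_cnt:
  assumes "d \<in> positions w a"
  shows "sorted_list_of_set (positions w a) ! cnt w a d = d"
  using nth_sorted_positions[OF cnt_positions_less[OF assms]] assms cnt_inj
  by (auto simp: positions_def)

lemma bij_betw_positions: "bij_betw (\<lambda>d. Suc (cnt w a d)) (positions w a) {1..count_list w a}"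
proof (rule bij_betw_imageI)
  show "inj_on (\<lambda>d. Suc (cnt w a d)) (positions w a)"
    using cnt_inj by (auto simp: inj_on_def positions_def)
  show "(\<lambda>d. Suc (cnt w a d)) ` positions w a = {1..count_list w a}"
  proof (intro equalityI subsetI)
    fix k assume "k \<in> {1..count_list w a}"
    then have "k - 1 < cnt w a (length w)" "k = Suc (k - 1)"
      by (auto simp: cnt_length)
    then show "k \<in> (\<lambda>d. Suc (cnt w a d)) ` positions w a"
      using cnt_surj[of "length w" w "k - 1" a] unfolding positions_def by force
  qed (use cnt_positions_less in force)
qed

text \<open>As \<open>cell\<close> is injective, the arrows in a strip can be counted as pairs. A
  row is only ever the first entry of an inversion and a column only the second, so conditions on
  these strips become conditions on one index.\<close>

lemma arrows_weight:
  assumes w: "is_word w" and R: "dom R \<subseteq> tiling w"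
  shows "\<alpha> ^ frow (w, R) * \<beta> ^ fcol (w, R) * (\<Prod>i=1..count_list w 1. z i ^ diag_arrows i (w, R)) =
    weight \<alpha> \<beta> z w (arrows w R)"
proof -
  have strp: "strip w d = {cell w i j |i j. inversion w i j \<and> (i = d \<or> j = d)}" if "d \<in> positions w a" for d a
    using strip_word[OF w] that by (simp add: positions_def)
  have "(\<forall>t\<in>strip w d. R t \<noteq> Some LeftArrow) \<longleftrightarrow> (\<forall>j. arrows w R d j \<noteq> Some LeftArrow)"
    if "d \<in> rows w" for d
  proof -
    have "\<not> inversion w i d" for i
      using that is_word_nth[OF w, of i] by (auto simp: inversion_def positions_def)
    then show ?thesis
      unfolding strp[OF that] by (auto simp: arrows_def)
  qed
  then have row: "frow (w, R) = card (free_rows w (arrows w R))"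
    unfolding frow.simps free_rows_def by (metis (no_types, lifting))
  have "(\<forall>t\<in>strip w d. R t \<noteq> Some UpArrow) \<longleftrightarrow> (\<forall>i. arrows w R i d \<noteq> Some UpArrow)"
    if "d \<in> columns w" for d
  proof -
    have "\<not> inversion w d j" for j
      using that by (auto simp: inversion_def positions_def)
    then show ?thesis
      unfolding strp[OF that] by (auto simp: arrows_def)
  qed
  then have col: "fcol (w, R) = card (free_cols w (arrows w R))"
    unfolding fcol.simps free_cols_def by (metis (no_types, lifting))
  have diag: "card {t \<in> strip w d. R t \<noteq> None} = card (diag_cells d (arrows w R))" if "d \<in> diagonals w" for d
  proof -
    have "{t \<in> strip w d. R t \<noteq> None} = (\<lambda>(i, j). cell w i j) ` diag_cells d (arrows w R)"
      unfolding strp[OF that] by (auto simp: arrows_def diag_cells_def image_iff split: if_splits) 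
    moreover have "inj_on (\<lambda>(i, j). cell w i j) (diag_cells d (arrows w R))"
      using cell_inj[OF w] by (auto simp: inj_on_def diag_cells_def arrows_def split: if_splits)
    ultimately show ?thesis
      by (simp add: card_image)
  qed
  have "(\<Prod>i=1..count_list w 1. z i ^ diag_arrows i (w, R)) =
      (\<Prod>d\<in>diagonals w. z (Suc (cnt w 1 d)) ^ diag_arrows (Suc (cnt w 1 d)) (w, R))"
    by (rule prod.reindex_bij_betw[OF bij_betw_positions, symmetric])
  also have "\<dots> = (\<Prod>d\<in>diagonals w. z (Suc (cnt w 1 d)) ^ card (diag_cells d (arrows w R)))"
    using diag by (intro prod.cong) (simp_all add: sorted_positions_nth_cnt)
  finally have "(\<Prod>i=1..count_list w 1. z i ^ diag_arrows i (w, R)) =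
      (\<Prod>d\<in>diagonals w. z (Suc (cnt w 1 d)) ^ card (diag_cells d (arrows w R)))" .
  then show ?thesis
    unfolding weight_def row col by simp
qed

lemma bij_betw_arrows:
  assumes w: "is_word w"
  shows "bij_betw (arrows w) {R. is_RAT w R} {f. tableau w f}"
proof -
  let ?c = "\<lambda>(i, j). cell w i j" and ?I = "{(i, j). inversion w i j}"
  \<comment> \<open>The inverse map reads a tile back as its pair of positions and puts
    \<open>None\<close> off the tiling, in line with the domain condition in
    \<open>is_RAT\<close>.\<close>
  define fill :: "(nat \<Rightarrow> nat \<Rightarrow> arrow option) \<Rightarrow> filling" where
    "fill f t = (if t \<in> tiling w then case_prod f (inv_into ?I ?c t) else None)" for f t
  have inj: "inj_on ?c ?I"
    using cell_inj[OF w] by (auto simp: inj_on_def)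
  have tiling: "tiling w = ?c ` ?I"
    unfolding tiling_eq[OF w] by auto
  have fill_cell: "fill f (cell w i j) = f i j" if "inversion w i j" for f i j
  proof -
    have "inv_into ?I ?c (?c (i, j)) = (i, j)"
      using that by (intro inv_into_f_f[OF inj]) auto
    then show ?thesis
      using that by (auto simp: fill_def tiling)
  qed
  have arrows_fill: "arrows w (fill f) = f" if "tableau w f" for f
  proof (intro ext)
    fix i j
    have "f i j = None" if "\<not> inversion w i j"
      using tableau_inversion[OF \<open>tableau w f\<close>] that by blast
    then show "arrows w (fill f) i j = f i j"
      by (auto simp: arrows_def fill_cell)
  qed
  have fill_dom: "dom (fill f) \<subseteq> tiling w" for f
    by (auto simp: fill_def split: if_splits)
  have fill_arrows: "fill (arrows w R) = R" if "dom R \<subseteq> tiling w" for R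
  proof
    fix t
    show "fill (arrows w R) t = R t"
    proof (cases "t \<in> tiling w")
      case True
      then show ?thesis
        by (auto simp: tiling fill_cell arrows_def)
    next
      case False
      then show ?thesis
        using that domIff[of t R] by (auto simp: fill_def)
    qed
  qed
  show ?thesis
    by (rule bij_betw_byWitness[where f' = fill])
      (use is_RAT_iff[OF w] arrows_fill fill_dom fill_arrows in force)+
qed

lemma sum_RAT_word:
  assumes w: "is_word w"
  shows "(\<Sum>R | is_RAT w R. \<alpha> ^ frow (w, R) * \<beta> ^ fcol (w, R) *
      (\<Prod>i=1..count_list w 1. z i ^ diag_arrows i (w, R))) = (\<Sum>f | tableau w f. weight \<alpha> \<beta> z w f)"
proof -
  have "(\<Sum>f | tableau w f. weight \<alpha> \<beta> z w f) = (\<Sum>R | is_RAT w R. weight \<alpha> \<beta> z w (arrows w R))"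
    by (rule sum.reindex_bij_betw[OF bij_betw_arrows[OF w], symmetric])
  also have "\<dots> = (\<Sum>R | is_RAT w R. \<alpha> ^ frow (w, R) * \<beta> ^ fcol (w, R) *
      (\<Prod>i=1..count_list w 1. z i ^ diag_arrows i (w, R)))"
    by (intro sum.cong refl arrows_weight[OF w, symmetric]) (simp add: is_RAT_iff[OF w])
  finally show ?thesis
    by (rule sym)
qed

section \<open>Appending a letter\<close>

text \<open>The strip of the new letter, at position \<open>n\<close>, receives left-arrows in the
  rows \<open>L\<close> and an up-arrow where it crosses the strip \<open>u\<close>. An option
  suffices: of two up-arrows in a column, one would point to the other.\<close>

definition extend :: "nat \<Rightarrow> (nat \<Rightarrow> nat \<Rightarrow> arrow option) \<Rightarrow> nat option \<Rightarrow> nat set \<Rightarrow> nat \<Rightarrow> nat \<Rightarrow> arrow option" where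
  "extend n f u L i j =
    (if j = n then if i \<in> L then Some LeftArrow else if u = Some i then Some UpArrow else None else f i j)"

text \<open>The rows that may take a left-arrow in a new column next to an up-arrow in the strip \<open>v\<close>: those which the
  column meets before \<open>v\<close>, hence all of them if \<open>v\<close> is diagonal.\<close>

definition left_rows :: "nat list \<Rightarrow> (nat \<Rightarrow> nat \<Rightarrow> arrow option) \<Rightarrow> nat option \<Rightarrow> nat set" where
  "left_rows w f u = {i \<in> free_rows w f. \<forall>v. u = Some v \<longrightarrow> w ! v = 1 \<or> v < i}"

text \<open>Only a column takes an up-arrow, and not in a row that has a left-arrow, since that
  arrow points to the new cell.\<close>

definition up_strips :: "nat list \<Rightarrow> nat \<Rightarrow> (nat \<Rightarrow> nat \<Rightarrow> arrow option) \<Rightarrow> nat option set" where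
  "up_strips w x f = insert None (if x = 0 then Some ` (free_rows w f \<union> diagonals w) else {})"

definition choices :: "nat list \<Rightarrow> nat \<Rightarrow> (nat \<Rightarrow> nat \<Rightarrow> arrow option) \<Rightarrow> (nat option \<times> nat set) set" where
  "choices w x f = (SIGMA u:up_strips w x f. Pow (if x < 2 then left_rows w f u else {}))"

text \<open>New cells are the last of their rows, so their left-arrows point to nothing, and old
  left-arrows point to them only in rows that are not free.\<close>

lemma tableau_extend:
  assumes w: "is_word w" and f: "tableau w f" and uL: "(u, L) \<in> choices w x f"
  shows "tableau (w @ [x]) (extend (length w) f u L)"
proof -
  let ?n = "length w" and ?g = "extend (length w) f u L"
  have inv: "inversion w i j" if "f i j = Some a" for i j a
    using tableau_inversion[OF f] that by simp
  have L: "i < ?n" "w ! i = 2" "\<And>j. f i j \<noteq> Some LeftArrow" "x < 2" "\<And>v. u = Some v \<Longrightarrow> w ! v = 1 \<or> v < i"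
    if "i \<in> L" for i
    using that uL by (auto simp: choices_def left_rows_def free_rows_def positions_def split: if_splits)
  have u: "x = 0" "v < ?n" "w ! v = 1 \<or> w ! v = 2 \<and> (\<forall>j. f v j \<noteq> Some LeftArrow)" if "u = Some v" for v
    using that uL by (auto simp: choices_def up_strips_def free_rows_def positions_def split: if_splits)
  show ?thesis
  proof (rule tableauI)
    fix i j assume "?g i j \<noteq> None"
    then show "inversion (w @ [x]) i j"
      using inv[of i j] L[of i] u[of i] by (auto simp: extend_def inversion_snoc split: if_splits)
  next
    fix i j assume g: "?g i j = Some LeftArrow"
    show "(w @ [x]) ! i = 2"
    proof (cases "j = ?n")
      case True
      then show ?thesis
        using g L[of i] by (auto simp: extend_def nth_append split: if_splits)
    next
      case False
      then have "f i j = Some LeftArrow"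
        using g by (simp add: extend_def)
      then show ?thesis
        using inv[of i j] tableau_left(1)[OF f] by (auto simp: inversion_def nth_append)
    qed
    fix j' assume j': "j < j'" "?g i j' \<noteq> None"
    show False
    proof (cases "j = ?n")
      case True
      then have "f i j' \<noteq> None" "?n < j'"
        using j' by (auto simp: extend_def split: if_splits)
      then show False
        using inv[of i j'] by (auto simp: inversion_def)
    next
      case False
      then have l: "f i j = Some LeftArrow"
        using g by (simp add: extend_def)
      then have "f i j' = None" "w ! i = 2"
        using tableau_left[OF f] j' by auto
      then show False
        using j' l L[of i] u[of i] by (auto simp: extend_def split: if_splits)
    qed
  next
    fix i j assume g: "?g i j = Some UpArrow"
    show "(w @ [x]) ! j = 0"
    proof (cases "j = ?n")
      case True
      then show ?thesis
        using g u[of i] by (auto simp: extend_def split: if_splits)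
    next
      case False
      then have "f i j = Some UpArrow"
        using g by (simp add: extend_def)
      then show ?thesis
        using inv[of i j] tableau_up(1)[OF f] by (auto simp: inversion_def nth_append)
    qed
    fix i' assume i': "later_in_column (w @ [x]) i' i" "?g i' j \<noteq> None"
    show False
    proof (cases "j = ?n")
      case True
      \<comment> \<open>Every other arrow of the new column is a left-arrow in \<open>L\<close>, and
        the column meets those before its up-arrow.\<close>
      then have "u = Some i" "i \<notin> L" "i' \<in> L \<or> i' = i"
        using g i'(2) by (auto simp: extend_def split: if_splits)
      then show False
        using i'(1) L[of i'] u[of i] by (auto simp: later_in_column_def nth_append)
    next
      case False
      then have l: "f i j = Some UpArrow" "f i' j \<noteq> None"
        using g i' by (simp_all add: extend_def)
      then have "inversion w i j" "inversion w i' j"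
        using inv by auto
      then have "later_in_column w i' i"
        using i'(1) by (auto simp: later_in_column_def nth_append inversion_def)
      then show False
        using tableau_up(2)[OF f l(1)] l(2) by simp
    qed
  qed
qed

lemma tableau_snocE:
  assumes w: "is_word (w @ [x])" and g: "tableau (w @ [x]) g"
  obtains f u L where "tableau w f" "(u, L) \<in> choices w x f" "g = extend (length w) f u L"
proof -
  let ?n = "length w"
  have inv: "inversion w i j \<or> (j = ?n \<and> i < ?n \<and> x < w ! i)" if "g i j = Some a" for i j a
    using tableau_inversion[OF g] that by (simp add: inversion_snoc)
  define f where "f i j = (if j = ?n then None else g i j)" for i j
  define L where "L = {i. g i ?n = Some LeftArrow}"
  \<comment> \<open>The choice is harmless: \<open>up_unique\<close> shows that there is at most one
    up-arrow.\<close>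
  define u where "u = (if \<exists>i. g i ?n = Some UpArrow then Some (SOME i. g i ?n = Some UpArrow) else None)"
  have f_inv: "inversion w i j" if "f i j = Some a" for i j a
    using that inv[of i j] by (auto simp: f_def split: if_splits)
  have f_less: "i < ?n" "j < ?n" if "f i j = Some a" for i j a
    using f_inv[OF that] by (auto simp: inversion_def)
  have f_g: "g i j = Some a" if "f i j = Some a" for i j a
    using that by (auto simp: f_def split: if_splits)
  have tab: "tableau w f"
  proof (rule tableauI)
    fix i j assume "f i j \<noteq> None"
    then show "inversion w i j"
      using f_inv by blast
  next
    fix i j assume fl: "f i j = Some LeftArrow"
    show "w ! i = 2"
      using tableau_left(1)[OF g f_g[OF fl]] f_less[OF fl] by (simp add: nth_append)
    fix j' assume "j < j'" "f i j' \<noteq> None"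
    then show False
      using tableau_left(2)[OF g f_g[OF fl]] f_g[of i j'] by auto
  next
    fix i j assume fu: "f i j = Some UpArrow"
    show "w ! j = 0"
      using tableau_up(1)[OF g f_g[OF fu]] f_less[OF fu] by (simp add: nth_append)
    fix i' assume i': "later_in_column w i' i" "f i' j \<noteq> None"
    then have "later_in_column (w @ [x]) i' i"
      using f_less[OF fu] f_less[of i' j] by (auto simp: later_in_column_def nth_append)
    then show False
      using i' tableau_up(2)[OF g f_g[OF fu]] f_g[of i' j] by auto
  qed
  have no_left: "f i j \<noteq> Some LeftArrow" if "g i ?n \<noteq> None" for i j
  proof
    assume l: "f i j = Some LeftArrow"
    then show False
      using tableau_left(2)[OF g f_g[OF l]] f_less[OF l] that by auto
  qed
  have up_last: "\<not> later_in_column (w @ [x]) i' i" if "g i ?n = Some UpArrow" "g i' ?n \<noteq> None" for i i'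
    using tableau_up(2)[OF g that(1)] that(2) by auto
  have col: "i < ?n" "x < w ! i" "(w @ [x]) ! i = w ! i" if "g i ?n = Some a" for i a
    using inv[OF that] by (auto simp: inversion_def nth_append)
  have left2: "w ! i = 2" if "g i ?n = Some LeftArrow" for i
    using tableau_left(1)[OF g that] col[OF that] by simp
  have up_x: "x = 0" if "g i ?n = Some UpArrow" for i
    using tableau_up(1)[OF g that] by simp
  \<comment> \<open>\<open>later_in_column\<close> compares any two distinct positions, so one of
    two up-arrows would point to the other.\<close>
  have up_unique: "i = i'" if "g i ?n = Some UpArrow" "g i' ?n = Some UpArrow" for i i'
    using up_last[of i i'] up_last[of i' i] that col[OF that(1)] col[OF that(2)]
    by (auto simp: later_in_column_def)
  have u_iff: "u = Some i \<longleftrightarrow> g i ?n = Some UpArrow" for i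
    using up_unique someI[of "\<lambda>i. g i ?n = Some UpArrow"] by (auto simp: u_def)
  have "u \<in> up_strips w x f"
  proof (cases u)
    case (Some v)
    then have v: "g v ?n = Some UpArrow"
      using u_iff by simp
    have "w ! v = 1 \<or> w ! v = 2"
      using is_word_nth[of w v] w col[OF v] by auto
    then show ?thesis
      using Some up_x[OF v] no_left[of v] v col[OF v]
      by (auto simp: up_strips_def free_rows_def positions_def)
  qed (simp add: up_strips_def)
  moreover have "L \<subseteq> (if x < 2 then left_rows w f u else {})"
  proof
    fix i assume "i \<in> L"
    then have i: "g i ?n = Some LeftArrow"
      by (simp add: L_def)
    have "i \<in> free_rows w f" "x < 2"
      using no_left[of i] i left2[OF i] col[OF i] by (auto simp: free_rows_def positions_def)
    moreover have "w ! v = 1 \<or> v < i" if "u = Some v" for v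
    proof -
      have v: "g v ?n = Some UpArrow"
        using that u_iff by simp
      have "w ! v = 1 \<or> w ! v = 2" "v \<noteq> i"
        using is_word_nth[of w v] w col[OF v] i v by auto
      moreover have "\<not> later_in_column (w @ [x]) i v"
        using up_last[OF v] i by simp
      ultimately show ?thesis
        using left2[OF i] col[OF i] col[OF v] by (auto simp: later_in_column_def)
    qed
    ultimately show "i \<in> (if x < 2 then left_rows w f u else {})"
      by (simp add: left_rows_def)
  qed
  ultimately have "(u, L) \<in> choices w x f"
    by (simp add: choices_def)
  moreover have "g = extend ?n f u L"
  proof (intro ext)
    fix i j
    show "g i j = extend ?n f u L i j"
    proof (cases "j = ?n")
      case True
      show ?thesis
      proof (cases "g i ?n")
        case None
        then show ?thesis
          using True u_iff[of i] by (simp add: extend_def L_def)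
      next
        case (Some a)
        then show ?thesis
          using True u_iff[of i] by (cases a) (simp_all add: extend_def L_def)
      qed
    qed (simp add: extend_def f_def)
  qed
  ultimately show ?thesis
    using tab that by blast
qed

lemma extend_inj:
  assumes "tableau w f" "(u, L) \<in> choices w x f" "tableau w f'" "(u', L') \<in> choices w x f'"
    and eq: "extend (length w) f u L = extend (length w) f' u' L'"
  shows "f = f' \<and> u = u' \<and> L = L'"
proof -
  let ?n = "length w"
  have last: "g i ?n = None" if "tableau w g" for g i
    using tableau_inversion[OF that, of i ?n] unfolding inversion_def by blast
  \<comment> \<open>\<open>extend\<close> gives \<open>L\<close> precedence over \<open>u\<close>,
    so \<open>u\<close> can be read off because it is never in \<open>L\<close>: it is either
    diagonal or smaller than all elements of \<open>L\<close>.\<close>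
  have disj: "v \<notin> L" if "u = Some v" "(u, L) \<in> choices w x f" for v u L f
    using that by (auto simp: choices_def left_rows_def free_rows_def positions_def split: if_splits)
  have e: "extend ?n f u L i j = extend ?n f' u' L' i j" for i j
    using eq by simp
  have "f i j = f' i j" for i j
    using e[of i j] last[OF assms(1)] last[OF assms(3)] by (cases "j = ?n") (simp_all add: extend_def)
  moreover have "i \<in> L \<longleftrightarrow> i \<in> L'" for i
    using e[of i ?n] by (auto simp: extend_def split: if_splits)
  moreover have "u = Some v \<longleftrightarrow> u' = Some v" for v
    using e[of v ?n] disj[OF _ assms(2), of v] disj[OF _ assms(4), of v]
    by (auto simp: extend_def split: if_splits)
  then have "u = u'"
    by (metis not_Some_eq)
  ultimately show ?thesis
    by (auto simp: fun_eq_iff)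
qed

lemma finite_free_rows [simp]: "finite (free_rows w f)"
  by (simp add: free_rows_def)

lemma finite_left_rows [simp]: "finite (left_rows w f u)"
  by (simp add: left_rows_def)

lemma finite_up_strips [simp]: "finite (up_strips w x f)"
  by (simp add: up_strips_def)

lemma finite_choices [simp]: "finite (choices w x f)"
  by (simp add: choices_def)

lemma tableaux_snoc:
  assumes w: "is_word (w @ [x])"
  shows "bij_betw (\<lambda>(f, u, L). extend (length w) f u L) (SIGMA f:{f. tableau w f}. choices w x f)
    {g. tableau (w @ [x]) g}"
proof (rule bij_betw_imageI)
  show "inj_on (\<lambda>(f, u, L). extend (length w) f u L) (SIGMA f:{f. tableau w f}. choices w x f)"
    by (rule inj_onI) (clarsimp, metis extend_inj)
  show "(\<lambda>(f, u, L). extend (length w) f u L) ` (SIGMA f:{f. tableau w f}. choices w x f) =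
      {g. tableau (w @ [x]) g}"
  proof (intro equalityI subsetI)
    fix g assume "g \<in> {g. tableau (w @ [x]) g}"
    then obtain f u L where "tableau w f" "(u, L) \<in> choices w x f" "g = extend (length w) f u L"
      using tableau_snocE[OF w] by blast
    then show "g \<in> (\<lambda>(f, u, L). extend (length w) f u L) ` (SIGMA f:{f. tableau w f}. choices w x f)"
      by (intro image_eqI[of _ _ "(f, u, L)"]) auto
  qed (use tableau_extend w in auto)
qed

lemma finite_tableaux: "is_word w \<Longrightarrow> finite {f. tableau w f}"
proof (induction w rule: rev_induct)
  case Nil
  have "f = (\<lambda>_ _. None)" if "tableau [] f" for f
  proof (intro ext)
    fix i j
    show "f i j = None"
      using tableau_inversion[OF that, of i j] by (cases "f i j") (auto simp: inversion_def)
  qed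
  then have "{f. tableau [] f} \<subseteq> {\<lambda>_ _. None}"
    by blast
  then show ?case
    by (rule finite_subset) simp
next
  case (snoc x w)
  then have "finite (SIGMA f:{f. tableau w f}. choices w x f)"
    by (intro finite_SigmaI) auto
  then show ?case
    using bij_betw_finite[OF tableaux_snoc[OF snoc.prems]] by blast
qed

lemma finite_RAT: "is_word w \<Longrightarrow> finite {R. is_RAT w R}"
  using bij_betw_finite[OF bij_betw_arrows] finite_tableaux by blast

lemma sum_tableaux_snoc:
  assumes "is_word (w @ [x])"
  shows "(\<Sum>g | tableau (w @ [x]) g. h g) =
    (\<Sum>f | tableau w f. \<Sum>(u, L)\<in>choices w x f. h (extend (length w) f u L))"
proof -
  have "(\<Sum>g | tableau (w @ [x]) g. h g) =
      (\<Sum>(f, u, L)\<in>(SIGMA f:{f. tableau w f}. choices w x f). h (extend (length w) f u L))"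
    by (subst sum.reindex_bij_betw[OF tableaux_snoc[OF assms], symmetric]) (simp add: case_prod_unfold)
  also have "\<dots> = (\<Sum>f | tableau w f. \<Sum>(u, L)\<in>choices w x f. h (extend (length w) f u L))"
    by (subst sum.Sigma) (use assms finite_tableaux in auto)
  finally show ?thesis .
qed

text \<open>The part of the weight without \<alpha>. With it, the sum over the fillings of a new
  strip becomes a change of \<alpha> for a fixed tableau.\<close>

definition rest_weight :: "'a::comm_ring_1 \<Rightarrow> (nat \<Rightarrow> 'a) \<Rightarrow> nat list \<Rightarrow> (nat \<Rightarrow> nat \<Rightarrow> arrow option) \<Rightarrow> 'a" where
  "rest_weight \<beta> z w f = \<beta> ^ card (free_cols w f) *
     (\<Prod>d\<in>diagonals w. z (Suc (cnt w 1 d)) ^ card (diag_cells d f))"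

lemma weight_rest: "weight \<alpha> \<beta> z w f = \<alpha> ^ card (free_rows w f) * rest_weight \<beta> z w f"
  by (simp add: weight_def rest_weight_def mult.assoc)

lemma positions_snoc:
  "positions (w @ [x]) a = positions w a \<union> (if x = a then {length w} else {})"
  by (auto simp: positions_def nth_append)

lemma length_notin_positions [simp]: "length w \<notin> positions w a"
  by (simp add: positions_def)

context
  fixes w x f u L
  assumes w: "is_word (w @ [x])" and f: "tableau w f" and uL: "(u, L) \<in> choices w x f"
begin

lemma f_last: "f i (length w) = None" "f (length w) j = None"
  using tableau_inversion[OF f, of i "length w"] tableau_inversion[OF f, of "length w" j]
  unfolding inversion_def by fastforce+

lemma L_subset: "L \<subseteq> free_rows w f"
  using uL by (auto simp: choices_def left_rows_def split: if_splits)

lemma u_cases: "u = Some v \<Longrightarrow> x = 0 \<and> (v \<in> free_rows w f \<or> v \<in> diagonals w)"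
  using uL by (auto simp: choices_def up_strips_def split: if_splits)

lemma free_rows_extend:
  "free_rows (w @ [x]) (extend (length w) f u L) =
    (free_rows w f - L) \<union> (if x = 2 then {length w} else {})"
proof -
  have "extend (length w) f u L i j \<noteq> Some LeftArrow \<longleftrightarrow> f i j \<noteq> Some LeftArrow \<and> (j = length w \<longrightarrow> i \<notin> L)" for i j
    using f_last(1)[of i] by (cases "j = length w") (simp_all add: extend_def)
  then have "(\<forall>j. extend (length w) f u L i j \<noteq> Some LeftArrow) \<longleftrightarrow> (\<forall>j. f i j \<noteq> Some LeftArrow) \<and> i \<notin> L" for i
    by blast
  moreover have "length w \<notin> L"
    using L_subset by (auto simp: free_rows_def)
  ultimately show ?thesis
    using f_last(2) by (auto simp: free_rows_def positions_snoc)
qed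

lemma free_cols_extend:
  "free_cols (w @ [x]) (extend (length w) f u L) =
    free_cols w f \<union> (if x = 0 \<and> u = None then {length w} else {})"
proof -
  have old: "(\<forall>i. extend (length w) f u L i j \<noteq> Some UpArrow) \<longleftrightarrow> (\<forall>i. f i j \<noteq> Some UpArrow)"
    if "j \<in> columns w" for j
    using that by (auto simp: extend_def positions_def)
  have "v \<notin> L" if "u = Some v" for v
    using that uL by (auto simp: choices_def left_rows_def free_rows_def positions_def split: if_splits)
  then have "(\<forall>i. extend (length w) f u L i (length w) \<noteq> Some UpArrow) \<longleftrightarrow> u = None"
    by (cases u) (auto simp: extend_def)
  then show ?thesis
    using old by (auto simp: free_cols_def positions_snoc)
qed

lemma diag_cells_old:
  assumes "d \<in> diagonals w"
  shows "diag_cells d (extend (length w) f u L) = diag_cells d f \<union> (if u = Some d then {(d, length w)} else {})"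
proof -
  have d: "d \<notin> L" "d < length w"
    using L_subset assms by (auto simp: free_rows_def positions_def)
  then show ?thesis
    using f_last by (auto simp: diag_cells_def extend_def split: if_splits)
qed

lemma diag_cells_new:
  assumes "x = 1"
  shows "diag_cells (length w) (extend (length w) f u L) = (\<lambda>i. (i, length w)) ` L"
proof -
  have "u = None"
    using u_cases assms by (cases u) auto
  then show ?thesis
    using f_last by (auto simp: diag_cells_def extend_def split: if_splits)
qed

lemma finite_diag_cells: "finite (diag_cells d f)"
proof (rule finite_subset)
  show "diag_cells d f \<subseteq> {..<length w} \<times> {..<length w}"
    using tableau_inversion[OF f] unfolding diag_cells_def inversion_def by fastforce
qed simp

lemma card_diag_cells:
  assumes "d \<in> diagonals w"
  shows "card (diag_cells d (extend (length w) f u L)) = card (diag_cells d f) + of_bool (u = Some d)"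
proof -
  have "(d, length w) \<notin> diag_cells d f"
    using f_last by (simp add: diag_cells_def)
  then show ?thesis
    using finite_diag_cells by (simp add: diag_cells_old[OF assms])
qed

text \<open>Each left-arrow makes one more row non-free, which costs a factor \<alpha>. A new column
  without up-arrow yields \<beta>, and an up-arrow in a diagonal strip yields the variable of that
  strip. A new diagonal strip collects its own variable once per left-arrow.\<close>

lemma weight_extend:
  "weight \<alpha> \<beta> z (w @ [x]) (extend (length w) f u L) =
    \<alpha> ^ (card (free_rows w f) - card L + of_bool (x = 2)) *
    (if x = 0 then case u of None \<Rightarrow> \<beta> | Some v \<Rightarrow> if w ! v = 1 then z (Suc (cnt w 1 v)) else 1 else 1) *
    (if x = 1 then z (Suc (count_list w 1)) ^ card L else 1) * rest_weight \<beta> z w f"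
proof -
  let ?g = "extend (length w) f u L"
  have rows: "card (free_rows (w @ [x]) ?g) = card (free_rows w f) - card L + of_bool (x = 2)"
  proof -
    have "length w \<notin> free_rows w f"
      by (simp add: free_rows_def)
    moreover have "card (free_rows w f - L) = card (free_rows w f) - card L"
      using L_subset by (intro card_Diff_subset) (auto intro: finite_subset)
    ultimately show ?thesis
      by (simp add: free_rows_extend)
  qed
  have cols: "card (free_cols (w @ [x]) ?g) = card (free_cols w f) + of_bool (x = 0 \<and> u = None)"
  proof -
    have "length w \<notin> free_cols w f" "finite (free_cols w f)"
      by (simp_all add: free_cols_def)
    then show ?thesis
      by (simp add: free_cols_extend)
  qed
  have old: "(\<Prod>d\<in>diagonals w. z (Suc (cnt (w @ [x]) 1 d)) ^ card (diag_cells d ?g)) =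
      (\<Prod>d\<in>diagonals w. z (Suc (cnt w 1 d)) ^ card (diag_cells d f)) *
      (\<Prod>d\<in>diagonals w. if u = Some d then z (Suc (cnt w 1 d)) else 1)"
    unfolding prod.distrib[symmetric]
    by (intro prod.cong refl) (simp only: card_diag_cells, simp add: positions_def)
  have "(\<Prod>d\<in>diagonals w. if u = Some d then z (Suc (cnt w 1 d)) else 1) =
      (case u of None \<Rightarrow> 1 | Some v \<Rightarrow> if w ! v = 1 then z (Suc (cnt w 1 v)) else 1)"
  proof (cases u)
    case (Some v)
    have "v \<in> diagonals w \<longleftrightarrow> w ! v = 1"
      using u_cases[OF Some] by (auto simp: positions_def free_rows_def)
    then show ?thesis
      using Some by (simp add: prod.delta' eq_commute[of v])
  qed simp
  moreover have "(\<Prod>d\<in>diagonals (w @ [x]). z (Suc (cnt (w @ [x]) 1 d)) ^ card (diag_cells d ?g)) =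
      (if x = 1 then z (Suc (count_list w 1)) ^ card L else 1) *
      (\<Prod>d\<in>diagonals w. z (Suc (cnt (w @ [x]) 1 d)) ^ card (diag_cells d ?g))"
    by (simp add: positions_snoc cnt_length diag_cells_new card_image inj_on_def flip: One_nat_def)
  moreover have "x = 0" if "u = Some v" for v
    using u_cases[OF that] by simp
  ultimately show ?thesis
    unfolding weight_def rest_weight_def rows cols old
    by (cases u) (auto simp: algebra_simps)
qed

end

section \<open>Sums over the fillings of a new strip\<close>

lemma sum_Pow_card:
  fixes \<alpha> y :: "'a::comm_ring_1"
  assumes "finite F" "A \<subseteq> F"
  shows "(\<Sum>L\<in>Pow A. \<alpha> ^ (card F - card L) * y ^ card L) = \<alpha> ^ (card F - card A) * (\<alpha> + y) ^ card A"
proof -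
  have A: "finite A" "card A \<le> card F"
    using assms finite_subset card_mono by auto
  \<comment> \<open>The product expands into choices of \<open>y\<close> on \<open>L\<close> and
    \<alpha> on the rest of \<open>A\<close>; elements of \<open>F\<close> outside \<open>A\<close>
    always contribute \<alpha>.\<close>
  have "(\<alpha> + y) ^ card A = (\<Prod>i\<in>A. y + \<alpha>)"
    by (simp add: add.commute)
  also have "\<dots> = (\<Sum>L\<in>Pow A. y ^ card L * \<alpha> ^ card (A - L))"
    unfolding prod_add[OF A(1)] by simp
  also have "\<alpha> ^ (card F - card A) * \<dots> = (\<Sum>L\<in>Pow A. \<alpha> ^ (card F - card L) * y ^ card L)"
    unfolding sum_distrib_left
  proof (intro sum.cong refl)
    fix L assume "L \<in> Pow A"
    then have L: "L \<subseteq> A" "finite L" "card L \<le> card A"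
      using A finite_subset card_mono by auto
    then have "card F - card L = (card F - card A) + card (A - L)"
      using A by (simp add: card_Diff_subset)
    then show "\<alpha> ^ (card F - card A) * (y ^ card L * \<alpha> ^ card (A - L)) = \<alpha> ^ (card F - card L) * y ^ card L"
      by (simp add: power_add mult_ac)
  qed
  finally show ?thesis ..
qed

text \<open>A telescoping sum: with \<open>m = card F\<close> and \<open>g\<close> elements above
  \<open>v\<close>, the term is \<alpha> times the difference of
  \<open>\<alpha> ^ (m - g - 1) * (\<alpha> + 1) ^ (g + 1)\<close> and
  \<open>\<alpha> ^ (m - g) * (\<alpha> + 1) ^ g\<close>. The induction removes the least element,
  which has all others above it.\<close>

lemma sum_greater_card:
  fixes \<alpha> :: "'a::comm_ring_1" and F :: "nat set"
  assumes "finite F"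
  shows "(\<Sum>v\<in>F. \<alpha> ^ (card F - card {i \<in> F. v < i}) * (\<alpha> + 1) ^ card {i \<in> F. v < i}) =
    \<alpha> * ((\<alpha> + 1) ^ card F - \<alpha> ^ card F)"
  using assms
proof (induction F rule: finite_linorder_min_induct)
  case (insert b F)
  have b: "b \<notin> F"
    using insert.hyps by auto
  have above: "{i \<in> insert b F. v < i} = {i \<in> F. v < i}" if "v \<in> F" for v
    using insert.hyps(2) that by auto
  have "{i \<in> insert b F. b < i} = F"
    using insert.hyps(2) by auto
  then have "(\<Sum>v\<in>insert b F. \<alpha> ^ (card (insert b F) - card {i \<in> insert b F. v < i}) *
        (\<alpha> + 1) ^ card {i \<in> insert b F. v < i}) =
      \<alpha> * (\<alpha> + 1) ^ card F + (\<Sum>v\<in>F. \<alpha> ^ (Suc (card F) - card {i \<in> F. v < i}) * (\<alpha> + 1) ^ card {i \<in> F. v < i})"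
    using insert.hyps(1) b above by (simp cong: sum.cong)
  also have "(\<Sum>v\<in>F. \<alpha> ^ (Suc (card F) - card {i \<in> F. v < i}) * (\<alpha> + 1) ^ card {i \<in> F. v < i}) =
      \<alpha> * (\<Sum>v\<in>F. \<alpha> ^ (card F - card {i \<in> F. v < i}) * (\<alpha> + 1) ^ card {i \<in> F. v < i})"
    unfolding sum_distrib_left
    by (intro sum.cong refl) (simp add: Suc_diff_le card_mono insert.hyps(1) mult.assoc)
  also note insert.IH
  finally show ?case
    using insert.hyps(1) b by (simp add: algebra_simps)
qed simp

lemma sum_choices_two:
  assumes "is_word w" "tableau w f"
  shows "(\<Sum>(u, L)\<in>choices w 2 f. weight \<alpha> \<beta> z (w @ [2]) (extend (length w) f u L)) = \<alpha> * weight \<alpha> \<beta> z w f"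
proof -
  have c: "choices w 2 f = {(None, {})}"
    by (auto simp: choices_def up_strips_def)
  show ?thesis
    using assms by (simp add: c weight_extend[where x = 2 and u = None and L = "{}"]) (simp add: weight_rest mult.assoc)
qed

lemma sum_choices_one:
  assumes "is_word w" "tableau w f"
  shows "(\<Sum>(u, L)\<in>choices w 1 f. weight \<alpha> \<beta> z (w @ [1]) (extend (length w) f u L)) =
    weight (\<alpha> + z (Suc (count_list w 1))) \<beta> z w f"
proof -
  have c: "choices w 1 f = {None} \<times> Pow (free_rows w f)"
    by (auto simp: choices_def up_strips_def left_rows_def)
  have "(\<Sum>(u, L)\<in>choices w 1 f. weight \<alpha> \<beta> z (w @ [1]) (extend (length w) f u L)) =
      (\<Sum>(u, L)\<in>choices w 1 f. \<alpha> ^ (card (free_rows w f) - card L) * z (Suc (count_list w 1)) ^ card L * rest_weight \<beta> z w f)"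
    by (intro sum.cong refl) (use weight_extend[of w 1 f] assms in auto)
  also have "\<dots> = (\<Sum>L\<in>Pow (free_rows w f). \<alpha> ^ (card (free_rows w f) - card L) * z (Suc (count_list w 1)) ^ card L) *
      rest_weight \<beta> z w f"
    unfolding c by (simp add: sum.cartesian_product[symmetric] sum_distrib_right)
  finally show ?thesis
    by (simp add: sum_Pow_card weight_rest)
qed

lemma sum_choices_zero:
  assumes "is_word w" "tableau w f"
  shows "(\<Sum>(u, L)\<in>choices w 0 f. weight \<alpha> \<beta> z (w @ [0]) (extend (length w) f u L)) =
    (\<alpha> + \<beta> + (\<Sum>i=1..count_list w 1. z i)) * weight (\<alpha> + 1) \<beta> z w f - \<alpha> * weight \<alpha> \<beta> z w f"
proof -
  let ?F = "free_rows w f" and ?A = "left_rows w f"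
  \<comment> \<open>\<open>m u\<close> is the factor for the place of the up-arrow.
    \<open>h u\<close> also sums over the left-arrows, which lie in squares and so meet no diagonal
    strip: they are the case \<open>y = 1\<close> of \<open>sum_Pow_card\<close>.\<close>
  define m where "m u = (case u of None \<Rightarrow> \<beta> | Some v \<Rightarrow> if w ! v = 1 then z (Suc (cnt w 1 v)) else 1)" for u
  define h where "h u = m u * (\<alpha> ^ (card ?F - card (?A u)) * (\<alpha> + 1) ^ card (?A u))" for u
  have sub: "?A u \<subseteq> ?F" for u
    by (auto simp: left_rows_def)
  have "(\<Sum>(u, L)\<in>choices w 0 f. weight \<alpha> \<beta> z (w @ [0]) (extend (length w) f u L)) =
      (\<Sum>(u, L)\<in>choices w 0 f. \<alpha> ^ (card ?F - card L) * m u * rest_weight \<beta> z w f)"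
    by (intro sum.cong refl) (use weight_extend[of w 0 f] assms in \<open>auto simp: m_def\<close>)
  also have "\<dots> = (\<Sum>u\<in>up_strips w 0 f. \<Sum>L\<in>Pow (?A u). \<alpha> ^ (card ?F - card L) * m u * rest_weight \<beta> z w f)"
    unfolding choices_def by (subst sum.Sigma) auto
  also have "\<dots> = (\<Sum>u\<in>up_strips w 0 f. h u) * rest_weight \<beta> z w f"
    unfolding sum_distrib_right
  proof (intro sum.cong refl)
    fix u
    have "(\<Sum>L\<in>Pow (?A u). \<alpha> ^ (card ?F - card L) * m u * rest_weight \<beta> z w f) =
        (\<Sum>L\<in>Pow (?A u). \<alpha> ^ (card ?F - card L) * 1 ^ card L) * (m u * rest_weight \<beta> z w f)"
      by (simp add: sum_distrib_right mult.assoc)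
    then show "(\<Sum>L\<in>Pow (?A u). \<alpha> ^ (card ?F - card L) * m u * rest_weight \<beta> z w f) = h u * rest_weight \<beta> z w f"
      unfolding sum_Pow_card[OF finite_free_rows sub] by (simp add: h_def mult_ac)
  qed
  also have "(\<Sum>u\<in>up_strips w 0 f. h u) = h None + (\<Sum>v\<in>?F. h (Some v)) + (\<Sum>d\<in>diagonals w. h (Some d))"
  proof -
    have "?F \<inter> diagonals w = {}"
      by (auto simp: free_rows_def positions_def)
    then have "(\<Sum>v\<in>?F \<union> diagonals w. h (Some v)) = (\<Sum>v\<in>?F. h (Some v)) + (\<Sum>d\<in>diagonals w. h (Some d))"
      by (intro sum.union_disjoint) auto
    then show ?thesis
      by (simp add: up_strips_def sum.reindex add.assoc)
  qed
  also have "h None = \<beta> * (\<alpha> + 1) ^ card ?F"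
    by (simp add: h_def m_def left_rows_def)
  \<comment> \<open>An up-arrow in the row \<open>v\<close> leaves only the later free rows for
    left-arrows, so these terms telescope.\<close>
  also have "(\<Sum>v\<in>?F. h (Some v)) = \<alpha> * ((\<alpha> + 1) ^ card ?F - \<alpha> ^ card ?F)"
  proof -
    have "h (Some v) = \<alpha> ^ (card ?F - card {i \<in> ?F. v < i}) * (\<alpha> + 1) ^ card {i \<in> ?F. v < i}" if "v \<in> ?F" for v
    proof -
      have "w ! v = 2"
        using that by (simp add: free_rows_def positions_def)
      then show ?thesis
        by (simp add: h_def m_def left_rows_def)
    qed
    then show ?thesis
      by (simp add: sum_greater_card)
  qed
  \<comment> \<open>A column meets its diagonal strips after all rows, so here every free row may
    take a left-arrow.\<close>
  also have "(\<Sum>d\<in>diagonals w. h (Some d)) = (\<Sum>i=1..count_list w 1. z i) * (\<alpha> + 1) ^ card ?F"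
  proof -
    have "h (Some d) = z (Suc (cnt w 1 d)) * (\<alpha> + 1) ^ card ?F" if "d \<in> diagonals w" for d
      using that by (simp add: h_def m_def left_rows_def positions_def)
    then have "(\<Sum>d\<in>diagonals w. h (Some d)) = (\<Sum>d\<in>diagonals w. z (Suc (cnt w 1 d))) * (\<alpha> + 1) ^ card ?F"
      by (simp add: sum_distrib_right)
    then show ?thesis
      by (simp only: sum.reindex_bij_betw[OF bij_betw_positions])
  qed
  finally show ?thesis
    by (simp add: weight_rest algebra_simps)
qed

section \<open>The recurrence in the length of the word\<close>

definition words :: "nat \<Rightarrow> nat \<Rightarrow> nat list set" where
  "words n r = {w. is_word w \<and> length w = n \<and> count_list w 1 = r}"

lemma finite_words [simp]: "finite (words n r)"
proof (rule finite_subset)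
  show "words n r \<subseteq> {w. set w \<subseteq> {0, 1, 2} \<and> length w = n}"
    by (auto simp: words_def is_word_def)
qed (simp add: finite_lists_length_eq)

lemma sum_words_Suc:
  "(\<Sum>w\<in>words (Suc n) r. h w) = (\<Sum>w\<in>words n r. h (w @ [2]) + h (w @ [0])) +
    (case r of 0 \<Rightarrow> 0 | Suc s \<Rightarrow> \<Sum>w\<in>words n s. h (w @ [1]))"
proof -
  define V where "V = (case r of 0 \<Rightarrow> {} | Suc s \<Rightarrow> words n s)"
  have eq: "words (Suc n) r = (\<lambda>w. w @ [2]) ` words n r \<union> (\<lambda>w. w @ [0]) ` words n r \<union> (\<lambda>w. w @ [1]) ` V"
  proof (intro equalityI subsetI)
    fix v assume v: "v \<in> words (Suc n) r"
    then obtain w x where "v = w @ [x]"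
      by (cases v rule: rev_cases) (auto simp: words_def)
    then show "v \<in> (\<lambda>w. w @ [2]) ` words n r \<union> (\<lambda>w. w @ [0]) ` words n r \<union> (\<lambda>w. w @ [1]) ` V"
      using v by (auto simp: words_def V_def split: nat.splits)
  qed (auto simp: words_def V_def split: nat.splits)
  have "finite V"
    by (simp add: V_def split: nat.splits)
  then have "(\<Sum>w\<in>words (Suc n) r. h w) =
      (\<Sum>w\<in>words n r. h (w @ [2])) + (\<Sum>w\<in>words n r. h (w @ [0])) + (\<Sum>w\<in>V. h (w @ [1]))"
    unfolding eq by (subst sum.union_disjoint | auto simp: sum.reindex inj_on_def)+
  then show ?thesis
    by (simp add: V_def sum.distrib split: nat.splits)
qed

definition gen_fun :: "'a::comm_ring_1 \<Rightarrow> 'a \<Rightarrow> (nat \<Rightarrow> 'a) \<Rightarrow> nat \<Rightarrow> nat \<Rightarrow> 'a" where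
  "gen_fun \<alpha> \<beta> z n r = (\<Sum>w\<in>words n r. \<Sum>f | tableau w f. weight \<alpha> \<beta> z w f)"

lemma gen_fun_Suc:
  "gen_fun \<alpha> \<beta> z (Suc n) r = (\<alpha> + \<beta> + (\<Sum>i=1..r. z i)) * gen_fun (\<alpha> + 1) \<beta> z n r +
    (case r of 0 \<Rightarrow> 0 | Suc s \<Rightarrow> gen_fun (\<alpha> + z r) \<beta> z n s)"
proof -
  have "(\<Sum>g | tableau (w @ [2]) g. weight \<alpha> \<beta> z (w @ [2]) g) + (\<Sum>g | tableau (w @ [0]) g. weight \<alpha> \<beta> z (w @ [0]) g) =
      (\<alpha> + \<beta> + (\<Sum>i=1..r. z i)) * (\<Sum>f | tableau w f. weight (\<alpha> + 1) \<beta> z w f)"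
    if "w \<in> words n r" for w
  proof -
    have w: "is_word w" "count_list w 1 = r"
      using that by (auto simp: words_def)
    have "(\<Sum>g | tableau (w @ [2]) g. weight \<alpha> \<beta> z (w @ [2]) g) = (\<Sum>f | tableau w f. \<alpha> * weight \<alpha> \<beta> z w f)"
      using w by (subst sum_tableaux_snoc) (auto intro!: sum.cong sum_choices_two)
    moreover have "(\<Sum>g | tableau (w @ [0]) g. weight \<alpha> \<beta> z (w @ [0]) g) =
        (\<Sum>f | tableau w f. (\<alpha> + \<beta> + (\<Sum>i=1..r. z i)) * weight (\<alpha> + 1) \<beta> z w f - \<alpha> * weight \<alpha> \<beta> z w f)"
      using w sum_choices_zero[OF w(1), unfolded w(2)] by (subst sum_tableaux_snoc) (auto intro!: sum.cong)
    ultimately show ?thesis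
      by (simp add: sum_subtractf sum_distrib_left)
  qed
  moreover have "(\<Sum>g | tableau (w @ [1]) g. weight \<alpha> \<beta> z (w @ [1]) g) =
      (\<Sum>f | tableau w f. weight (\<alpha> + z (Suc s)) \<beta> z w f)" if "w \<in> words n s" for w s
  proof -
    have w: "is_word w" "count_list w 1 = s"
      using that by (auto simp: words_def)
    show ?thesis
      using w sum_choices_one[OF w(1), unfolded w(2)] by (subst sum_tableaux_snoc) (auto intro!: sum.cong)
  qed
  ultimately show ?thesis
    unfolding gen_fun_def sum_words_Suc sum_distrib_left by (simp split: nat.splits)
qed

lemma words_0: "words 0 r = (if r = 0 then {[]} else {})"
  by (auto simp: words_def is_word_def)

text \<open>\<alpha> is generalized because the recurrence shifts it. If \<open>X\<close> is the
  base of the rising factorial, the shift by 1 leads to \<open>X + 1\<close>, and the shift by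
  \<open>z r\<close> supplies the variable missing for \<open>r - 1\<close>, so both terms become
  rising factorials of \<open>X\<close>.\<close>

lemma gen_fun_eq:
  "gen_fun \<alpha> \<beta> z n r = of_nat (n choose r) * pochhammer (\<alpha> + \<beta> + (\<Sum>i=1..r. z i)) (n - r)"
proof (induction n arbitrary: \<alpha> r)
  case 0
  have "{f. tableau [] f} = {\<lambda>_ _. None}"
    by (auto simp: tableau_def inversion_def fun_eq_iff)
  then have "gen_fun \<alpha> \<beta> z 0 0 = weight \<alpha> \<beta> z [] (\<lambda>_ _. None)"
    by (simp add: gen_fun_def words_0)
  also have "\<dots> = 1"
    by (simp add: weight_def free_rows_def free_cols_def positions_def)
  finally show ?case
    by (cases r) (simp_all add: gen_fun_def words_0)
next
  case (Suc n)
  let ?Z = "\<lambda>r. (\<Sum>i=1..r. z i)"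
  let ?X = "\<alpha> + \<beta> + ?Z r"
  \<comment> \<open>For \<open>r\<close> at most \<open>n\<close> the factor \<open>?X\<close>
    completes the rising factorial of \<open>?X + 1\<close>; for larger \<open>r\<close> both sides
    vanish with the binomial coefficient.\<close>
  have step: "?X * gen_fun (\<alpha> + 1) \<beta> z n r = of_nat (n choose r) * pochhammer ?X (Suc n - r)"
  proof (cases "r \<le> n")
    case True
    have "gen_fun (\<alpha> + 1) \<beta> z n r = of_nat (n choose r) * pochhammer (?X + 1) (n - r)"
      using Suc.IH[of "\<alpha> + 1" r] by (simp add: add_ac)
    then show ?thesis
      using True by (simp add: Suc_diff_le pochhammer_rec mult_ac)
  qed (simp add: Suc.IH binomial_eq_0)
  show ?case
  proof (cases r)
    case 0
    then show ?thesis
      using step by (simp add: gen_fun_Suc)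
  next
    case (Suc s)
    have "\<alpha> + z r + \<beta> + ?Z s = ?X"
      using Suc by simp
    then have "gen_fun (\<alpha> + z r) \<beta> z n s = of_nat (n choose s) * pochhammer ?X (Suc n - r)"
      using Suc Suc.IH[of "\<alpha> + z r" s] by (simp add: add_ac)
    then show ?thesis
      using step Suc by (simp add: gen_fun_Suc algebra_simps)
  qed
qed

theorem theorem4p10:
  fixes n r :: nat and \<alpha> \<beta> :: "'a::comm_ring_1" and z :: "nat \<Rightarrow> 'a"
  assumes "r \<le> n"
  shows "(\<Sum>R\<in>RAT n r. \<alpha> ^ frow R * \<beta> ^ fcol R * (\<Prod>i=1..r. z i ^ diag_arrows i R)) =
         of_nat (n choose r) * pochhammer (\<alpha> + \<beta> + (\<Sum>i=1..r. z i)) (n - r)"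
proof -
  have "RAT n r = (SIGMA w:words n r. {R. is_RAT w R})"
    by (auto simp: RAT_def words_def)
  moreover have "\<forall>w\<in>words n r. finite {R. is_RAT w R}"
    by (auto simp: words_def intro: finite_RAT)
  ultimately have "(\<Sum>R\<in>RAT n r. \<alpha> ^ frow R * \<beta> ^ fcol R * (\<Prod>i=1..r. z i ^ diag_arrows i R)) =
      (\<Sum>w\<in>words n r. \<Sum>R | is_RAT w R. \<alpha> ^ frow (w, R) * \<beta> ^ fcol (w, R) * (\<Prod>i=1..r. z i ^ diag_arrows i (w, R)))"
    by (subst sum.Sigma) (simp_all add: case_prod_unfold del: frow.simps fcol.simps diag_arrows.simps)
  also have "\<dots> = gen_fun \<alpha> \<beta> z n r"
    unfolding gen_fun_def
  proof (intro sum.cong refl)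
    fix w assume "w \<in> words n r"
    then have w: "is_word w" "count_list w 1 = r"
      by (auto simp: words_def)
    show "(\<Sum>R | is_RAT w R. \<alpha> ^ frow (w, R) * \<beta> ^ fcol (w, R) * (\<Prod>i=1..r. z i ^ diag_arrows i (w, R))) =
        (\<Sum>f | tableau w f. weight \<alpha> \<beta> z w f)"
      using sum_RAT_word[OF w(1), unfolded w(2)] .
  qed
  finally show ?thesis
    by (simp add: gen_fun_eq)
qed

end
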